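(* Let $m\ge4$ and consider a camera arrangement $\mathcal{C}(\boldsymbol u)=(C(u_1),\dots,C(u_m))$, $\boldsymbol u\in\mathbb{C}^m$, with $m$ distinct camera centers. Then $\widetilde{I}_{\mathcal{C}(\boldsymbol u)}$ is the vanishing ideal of the corresponding line multiview variety: $$\widetilde{I}_{\mathcal{C}(\boldsymbol u)}=I(\mathcal{L}_{\mathcal{C}(\boldsymbol u)}).$$
   Context: $\mathbb{C}[\boldsymbol\ell]=\mathbb{C}[\ell_{i,j}\mid1\le i\le3,\ 1\le j\le m]$, $\ell_j=(\ell_{1,j},\ell_{2,j},\ell_{3,j})^T$. Let $C(u_i)=\begin{bmatrix}1&0&0&u_i\\0&1&0&0\\0&0&1&0\end{bmatrix}$; its center (kernel) is $(u_i:0:0:-1)\in\mathbb{P}^3$. For $\sigma=\{i_1<i_2<i_3<i_4\}\subseteq[m]$ let $\Phi_{\mathcal{C}(\boldsymbol u),f,\sigma}(\ell)$ be the $10\times10$ matrix obtained by applying $\nu(x,y,z,w)=(x^2,y^2,z^2,w^2,xy,xz,xw,yz,yw,zw)^T$ to each of the ten column vectors $(1,0,0,0)$, $(0,0,0,1)$, $(1,0,0,1)$, $f_1=(0,1,0,0)$, $f_2=(0,0,1,0)$, $f_3=(0,1,1,0)$, and $e_i=(u_i,-\ell_{3,i},\ell_{2,i},-1)$ for $i=i_1,i_2,i_3,i_4$ (in this order). Then $$\widetilde{I}_{\mathcal{C}(\boldsymbol u)}=\left\langle3\times3\text{-minors of }\begin{bmatrix}C(u_1)^T\ell_1&\cdots&C(u_m)^T\ell_m\end{bmatrix}\right\rangle+\sum_{\sigma\in\binom{[m]}{4}}\langle\det\Phi_{\mathcal{C}(\boldsymbol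 u),f,\sigma}(\ell)\rangle\subseteq\mathbb{C}[\boldsymbol\ell].$$ For an arrangement $\mathcal{C}=(C_1,\dots,C_m)$ of rank-$3$ matrices in $\mathbb{C}^{3\times4}$ with distinct centers, the line multiview variety $\mathcal{L}_{\mathcal{C}}\subseteq(\mathbb{P}^2)^m$ is the Zariski closure of the set of tuples $(\ell_1,\dots,\ell_m)$, $\ell_i=(C_ia)\times(C_ib)$ (cross product), where $a,b$ span a line in $\mathbb{P}^3$ containing no center; $I(\mathcal{L}_{\mathcal{C}})\subseteq\mathbb{C}[\boldsymbol\ell]$ is the (multihomogeneous) ideal of all polynomials vanishing on $\mathcal{L}_{\mathcal{C}}$, i.e. at all $(\ell_1,\dots,\ell_m)\in(\mathbb{C}^3\setminus\{0\})^m$ representing points of $\mathcal{L}_{\mathcal{C}}$. *)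

theory Defs
  imports "HOL-Analysis.Analysis" "HOL-Library.Poly_Mapping" "HOL-Library.Set_Algebras"
begin

text \<open>
  The polynomial ring in the variables \<open>Var i j\<close> with \<open>i\<close> ranging over the three coordinates and
  \<open>j\<close> over the \<open>m = CARD('m)\<close> cameras: finitely supported coefficient functions on monomials, a
  monomial being its exponent function.  Coordinates of a \<open>vec\<close> of numeral dimension \<open>n\<close> are
  addressed \<open>1, ..., n\<close> as usual (in the numeral type, \<open>n = 0\<close>).
\<close>

type_synonym 'm lpoly = "((3 \<times> 'm) \<Rightarrow>\<^sub>0 nat) \<Rightarrow>\<^sub>0 complex"

definition Const :: "complex \<Rightarrow> 'm lpoly" where
  "Const c = Poly_Mapping.single 0 c"

definition Var :: "3 \<Rightarrow> 'm \<Rightarrow> 'm lpoly" where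
  "Var i j = Poly_Mapping.single (Poly_Mapping.single (i, j) 1) 1"

definition lvec :: "'m \<Rightarrow> 'm lpoly ^ 3" where
  "lvec j = (\<chi> i. Var i j)"

text \<open>Evaluation at a tuple of vectors; \<open>l $ j\<close> is the vector substituted for \<open>lvec j\<close>.\<close>

definition eval_lpoly :: "'m::finite lpoly \<Rightarrow> complex ^ 3 ^ 'm \<Rightarrow> complex" where
  "eval_lpoly p l = (\<Sum>t\<in>Poly_Mapping.keys p.
     Poly_Mapping.lookup p t * (\<Prod>(i, j)\<in>UNIV. (l $ j $ i) ^ Poly_Mapping.lookup t (i, j)))"

definition multihomogeneous :: "'m lpoly \<Rightarrow> bool" where
  "multihomogeneous p \<longleftrightarrow>
     (\<exists>d. \<forall>t\<in>Poly_Mapping.keys p. \<forall>j. (\<Sum>i\<in>UNIV. Poly_Mapping.lookup t (i, j)) = d j)"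

text \<open>The submodules of a commutative ring over itself are its ideals; \<open>ideal.span S\<close> is the
  ideal generated by \<open>S\<close>.\<close>

interpretation ideal: module "(*) :: 'a::comm_ring_1 \<Rightarrow> 'a \<Rightarrow> 'a"
  by unfold_locales (simp_all add: algebra_simps)

text \<open>Minors use increasing choices of rows and columns.  In the order of a numeral type \<open>n\<close> the
  index \<open>n = 0\<close> comes first, which affects minors only up to sign.\<close>

definition minors3 :: "'a::comm_ring_1 ^ 'n::{finite,linorder} ^ 'k::{finite,linorder} \<Rightarrow> 'a set" where
  "minors3 A = {det ((\<chi> p q. A $ r p $ c q) :: 'a ^ 3 ^ 3) | (r :: 3 \<Rightarrow> 'k) (c :: 3 \<Rightarrow> 'n).
     strict_mono r \<and> strict_mono c}"

definition cross :: "'a::comm_ring_1 ^ 3 \<Rightarrow> 'a ^ 3 \<Rightarrow> 'a ^ 3" where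
  "cross x y = vector [x $ 2 * y $ 3 - x $ 3 * y $ 2,
                       x $ 3 * y $ 1 - x $ 1 * y $ 3,
                       x $ 1 * y $ 2 - x $ 2 * y $ 1]"

text \<open>The center of a rank-3 camera, a point of projective 3-space, as the line of
  vectors representing it.\<close>

definition center :: "complex ^ 4 ^ 3 \<Rightarrow> (complex ^ 4) set" where
  "center C = {x. C *v x = 0}"

definition camera :: "complex \<Rightarrow> complex ^ 4 ^ 3" where
  "camera u = vector [vector [1, 0, 0, u],
                      vector [0, 1, 0, 0],
                      vector [0, 0, 1, 0]]"

text \<open>
  Subsets of the \<open>m\<close>-fold product of the projective plane are given by the set of all tuples of
  nonzero vectors representing their points.  The closed sets of the product are the common zero
  sets of families of multihomogeneous polynomials.
\<close>

definition zariski_closure :: "(complex ^ 3 ^ 'm::finite) set \<Rightarrow> (complex ^ 3 ^ 'm) set" where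
  "zariski_closure S = {l. (\<forall>j. l $ j \<noteq> 0) \<and>
     (\<forall>p. multihomogeneous p \<and> (\<forall>x\<in>S. eval_lpoly p x = 0) \<longrightarrow> eval_lpoly p l = 0)}"

definition line_images :: "('m::finite \<Rightarrow> complex ^ 4 ^ 3) \<Rightarrow> (complex ^ 3 ^ 'm) set" where
  "line_images C = {l. \<exists>a b. vec.dim (vec.span {a, b}) = 2 \<and>
     (\<forall>i. vec.span {a, b} \<inter> center (C i) = {0}) \<and>
     (\<forall>i. \<exists>c. c \<noteq> 0 \<and> l $ i = c *s cross (C i *v a) (C i *v b))}"

definition line_multiview_variety :: "('m::finite \<Rightarrow> complex ^ 4 ^ 3) \<Rightarrow> (complex ^ 3 ^ 'm) set" where
  "line_multiview_variety C = zariski_closure (line_images C)"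

definition vanishing_ideal :: "(complex ^ 3 ^ 'm::finite) set \<Rightarrow> 'm lpoly set" where
  "vanishing_ideal S = {p. \<forall>l\<in>S. eval_lpoly p l = 0}"

definition nu :: "'a::comm_ring_1 ^ 4 \<Rightarrow> 'a ^ 10" where
  "nu v = (let x = v $ 1; y = v $ 2; z = v $ 3; w = v $ 4 in
     vector [x\<^sup>2, y\<^sup>2, z\<^sup>2, w\<^sup>2, x * y, x * z, x * w, y * z, y * w, z * w])"

definition e_point :: "complex ^ 'm \<Rightarrow> 'm \<Rightarrow> 'm lpoly ^ 4" where
  "e_point u i = vector [Const (u $ i), - Var 3 i, Var 2 i, - 1]"

definition Phi :: "complex ^ 'm \<Rightarrow> 'm \<times> 'm \<times> 'm \<times> 'm \<Rightarrow> 'm lpoly ^ 10 ^ 10" where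
  "Phi u = (\<lambda>(i1, i2, i3, i4). transpose (vector
     [nu (vector [1, 0, 0, 0]), nu (vector [0, 0, 0, 1]), nu (vector [1, 0, 0, 1]),
      nu (vector [0, 1, 0, 0]), nu (vector [0, 0, 1, 0]), nu (vector [0, 1, 1, 0]),
      nu (e_point u i1), nu (e_point u i2), nu (e_point u i3), nu (e_point u i4)]))"

definition quadruples :: "('m::linorder \<times> 'm \<times> 'm \<times> 'm) set" where
  "quadruples = {(i1, i2, i3, i4). i1 < i2 \<and> i2 < i3 \<and> i3 < i4}"

definition plane_matrix :: "('m::finite \<Rightarrow> complex ^ 4 ^ 3) \<Rightarrow> 'm lpoly ^ 'm ^ 4" where
  "plane_matrix C = (\<chi> r j. (map_matrix Const (transpose (C j)) *v lvec j) $ r)"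

text \<open>The sums below are sums of ideals, i.e. elementwise sums of sets.\<close>

definition I_tilde :: "complex ^ 'm::{finite,linorder} \<Rightarrow> 'm lpoly set" where
  "I_tilde u = ideal.span (minors3 (plane_matrix (\<lambda>i. camera (u $ i))))
     + (\<Sum>s\<in>quadruples. ideal.span {det (Phi u s)})"

end

theory Submission
  imports Defs
begin

text \<open>Write \<open>(x\<^sub>j, y\<^sub>j, z\<^sub>j)\<close> for \<open>l\<^sub>j\<close>. The image of a line in the camera \<open>C(u\<^sub>j)\<close> is a multiple of
\<open>(A, B + u\<^sub>j B', C + u\<^sub>j C')\<close>, where \<open>A, B, B', C, C'\<close> are Pluecker coordinates of the line. If
\<open>A \<noteq> 0\<close>, the Pluecker relation merely determines the sixth coordinate, so that the tuples
\<open>s\<^sub>j (1, b + u\<^sub>j c, d + u\<^sub>j e)\<close> with free \<open>b, c, d, e\<close> and \<open>s\<^sub>j \<noteq> 0\<close> are all images of lines. A polynomial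
that vanishes on these tuples will be shown to lie in \<open>I_tilde u\<close>, and the elements of \<open>I_tilde u\<close>
vanish at all images of lines and then on the closure; this gives the theorem.

The ideal \<open>I_tilde u\<close> is generated by the \<open>3 \<times> 3\<close> determinants with rows \<open>(x, ux, y)\<close>, \<open>(x, ux, z)\<close>,
\<open>(x, y, z)\<close>, \<open>(ux, y, z)\<close>, and by the \<open>4 \<times> 4\<close> determinants with rows \<open>(y, z, uy, uz)\<close>: the six points
that are common to all the matrices \<open>Phi u s\<close> leave only the monomials \<open>xy, xz, yw, zw\<close> for the last
four points (\<open>det_Phi\<close>). On the images of lines, the rows of the former lie in the span of \<open>s\<close> and
\<open>us\<close>, and those of the latter in the span of \<open>s\<close>, \<open>us\<close>, \<open>u\<^sup>2s\<close>, so all these determinants vanish there.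

For the converse, let \<open>p\<close> vanish at all points \<open>(1, b + u\<^sub>j c, d + u\<^sub>j e)\<close>. Rescaling cameras and
coordinates separates \<open>p\<close> into components of fixed degree in each camera and in each of the letters
\<open>x, y, z\<close>, so let \<open>p\<close> be such a component, and proceed by induction on the degree. Let \<open>a\<close> be a camera
that occurs in \<open>p\<close>. The points with \<open>y\<^sub>a = 0\<close> form a subfamily, in which \<open>y\<^sub>j\<close> is a constant multiple of
\<open>u\<^sub>j - u\<^sub>a\<close>, and in it the point with \<open>z\<^sub>a = 0\<close> is unique up to scaling. At one point, the monomials
of a given degree take values in \<open>\<complex>\<close>, so the vanishing of \<open>p\<close> there puts \<open>p\<close> into an ideal as soon as
monomials of equal degree agree, up to the ratio of their values, modulo that ideal. Two such
monomials are joined by exchanges \<open>v\<^sub>j w\<^sub>k \<mapsto> w\<^sub>j v\<^sub>k\<close> of letters, and for the ideal generated by \<open>y\<^sub>a\<close>,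
\<open>z\<^sub>a\<close> and the determinants every exchange in the presence of \<open>x\<^sub>a\<close> is the expansion of a determinant
with the columns \<open>a, j, k\<close> (\<open>exchange_in_ideal\<close>, \<open>one_point_descent\<close>).

From there one climbs back. If \<open>p\<close> vanishes on the family \<open>y\<^sub>a = 0\<close>, then \<open>p\<close> is congruent to a multiple
\<open>z\<^sub>a q\<close>, and \<open>q\<close> vanishes on the family too, because \<open>z\<^sub>a\<close> is nonzero on a dense part of it; the degree
has dropped (\<open>pencil_descent\<close>). The last step divides by \<open>y\<^sub>a\<close> in the same way
(\<open>component_in_generated_ideal\<close>). The delicate case is that the camera \<open>a\<close> no longer occurs in \<open>q\<close>.
Then no \<open>x\<^sub>a\<close> is available, but the factor \<open>z\<^sub>a\<close> is: in its presence the letters \<open>x\<close> and \<open>y\<close> become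
interchangeable, and one specialises further to \<open>z\<^sub>b = 0\<close> for a camera \<open>b\<close> that occurs in \<open>q\<close>. It is here
that the \<open>4 \<times> 4\<close> determinants, with the columns \<open>a, b, j, k\<close>, are used
(\<open>one_point_descent_below_z\<close>, \<open>pencil_descent_below_z\<close>).\<close>

(* For the ring as a module over itself, this rule is associativity from right to left, and it
   makes the simplifier loop with the normal form of algebra_simps. *)
declare ideal.scale_scale [simp del]

section \<open>Determinants of the quadric matrices\<close>

text \<open>The permutations that contribute to the Leibniz formula fix every index outside \<open>S\<close>, so the
determinant is that of the block with rows and columns in \<open>S\<close>. The condition is weaker than having
unit rows outside \<open>S\<close>: it suffices that injectivity forces the diagonal.\<close>

lemma det_forced_diagonal:
  fixes A :: "'a::comm_ring_1 ^ 'n ^ 'n"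
  assumes forced: "\<And>p. p permutes UNIV \<Longrightarrow> \<forall>i. A $ i $ p i \<noteq> 0 \<Longrightarrow> \<forall>i\<in>-S. p i = i"
    and one: "\<And>i. i \<notin> S \<Longrightarrow> A $ i $ i = 1"
  shows "det A = (\<Sum>p\<in>{p. p permutes S}. of_int (sign p) * (\<Prod>i\<in>S. A $ i $ p i))"
proof -
  have "det A = (\<Sum>p\<in>{p. p permutes S}. of_int (sign p) * (\<Prod>i\<in>UNIV. A $ i $ p i))"
    unfolding det_def
  proof (rule sum.mono_neutral_right)
    show "{p. p permutes S} \<subseteq> {p. p permutes UNIV}"
      by (auto intro: permutes_subset)
    show "\<forall>p\<in>{p. p permutes UNIV} - {p. p permutes S}.
        of_int (sign p) * (\<Prod>i\<in>UNIV. A $ i $ p i) = 0"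
    proof
      fix p assume p: "p \<in> {p. p permutes UNIV} - {p. p permutes S}"
      then have "\<exists>i\<in>-S. p i \<noteq> i"
        by (metis (mono_tags, lifting) ComplI DiffE mem_Collect_eq permutes_superset subset_UNIV Diff_iff)
      then obtain i where "A $ i $ p i = 0"
        using forced[of p] p by blast
      then show "of_int (sign p) * (\<Prod>i\<in>UNIV. A $ i $ p i) = 0"
        by (metis UNIV_I finite_class.finite_UNIV mult_zero_right prod_zero)
    qed
  qed simp
  also have "\<dots> = (\<Sum>p\<in>{p. p permutes S}. of_int (sign p) * (\<Prod>i\<in>S. A $ i $ p i))"
  proof (rule sum.cong[OF refl])
    fix p assume "p \<in> {p. p permutes S}"
    then have "\<And>i. i \<notin> S \<Longrightarrow> A $ i $ p i = 1"
      using one by (simp add: permutes_not_in)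
    then have "(\<Prod>i\<in>UNIV. A $ i $ p i) = (\<Prod>i\<in>S. A $ i $ p i)"
      by (intro prod.mono_neutral_right) auto
    then show "of_int (sign p) * (\<Prod>i\<in>UNIV. A $ i $ p i)
        = of_int (sign p) * (\<Prod>i\<in>S. A $ i $ p i)" by simp
  qed
  finally show ?thesis .
qed

lemma vector_4:
  "(vector [a,b,c,d] :: 'a::zero ^ 4) $ 1 = a"
  "(vector [a,b,c,d] :: 'a ^ 4) $ 2 = b"
  "(vector [a,b,c,d] :: 'a ^ 4) $ 3 = c"
  "(vector [a,b,c,d] :: 'a ^ 4) $ 4 = d"
  unfolding vector_def by simp_all

lemma vector_10:
  "(vector [a,b,c,d,e,f,g,h,i,j] :: 'a::zero ^ 10) $ 1 = a"
  "(vector [a,b,c,d,e,f,g,h,i,j] :: 'a ^ 10) $ 2 = b"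
  "(vector [a,b,c,d,e,f,g,h,i,j] :: 'a ^ 10) $ 3 = c"
  "(vector [a,b,c,d,e,f,g,h,i,j] :: 'a ^ 10) $ 4 = d"
  "(vector [a,b,c,d,e,f,g,h,i,j] :: 'a ^ 10) $ 5 = e"
  "(vector [a,b,c,d,e,f,g,h,i,j] :: 'a ^ 10) $ 6 = f"
  "(vector [a,b,c,d,e,f,g,h,i,j] :: 'a ^ 10) $ 7 = g"
  "(vector [a,b,c,d,e,f,g,h,i,j] :: 'a ^ 10) $ 8 = h"
  "(vector [a,b,c,d,e,f,g,h,i,j] :: 'a ^ 10) $ 9 = i"
  "(vector [a,b,c,d,e,f,g,h,i,j] :: 'a ^ 10) $ 10 = j"
  unfolding vector_def by simp_all

lemma exhaust_10:
  fixes x :: 10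
  shows "x = 1 \<or> x = 2 \<or> x = 3 \<or> x = 4 \<or> x = 5 \<or> x = 6 \<or> x = 7 \<or> x = 8 \<or> x = 9 \<or> x = 10"
proof (induct x)
  case (of_int z)
  then have "0 \<le> z" and "z < 10" by simp_all
  then have "z = 0 \<or> z = 1 \<or> z = 2 \<or> z = 3 \<or> z = 4 \<or> z = 5 \<or> z = 6 \<or> z = 7 \<or> z = 8 \<or> z = 9"
    by arith
  then show ?case by auto
qed

lemma nu_nth:
  "nu v $ 1 = (v $ 1)\<^sup>2" "nu v $ 2 = (v $ 2)\<^sup>2" "nu v $ 3 = (v $ 3)\<^sup>2" "nu v $ 4 = (v $ 4)\<^sup>2"
  "nu v $ 5 = v $ 1 * v $ 2" "nu v $ 6 = v $ 1 * v $ 3" "nu v $ 7 = v $ 1 * v $ 4"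
  "nu v $ 8 = v $ 2 * v $ 3" "nu v $ 9 = v $ 2 * v $ 4" "nu v $ 10 = v $ 3 * v $ 4"
  by (simp_all add: nu_def Let_def vector_10)

text \<open>The Leibniz formula of a \<open>4 \<times> 4\<close> block, written as Laplace expansion along its first two rows.\<close>

lemma sum_permutes_4:
  fixes F :: "10 \<Rightarrow> 10 \<Rightarrow> 'a::comm_ring_1"
  shows "(\<Sum>p\<in>{p. p permutes {7, 8, 9, 10::10}}. of_int (sign p) * (\<Prod>i\<in>{7,8,9,10}. F i (p i)))
   = (F 7 7 * F 8 8 - F 7 8 * F 8 7) * (F 9 9 * F 10 10 - F 9 10 * F 10 9)
   - (F 7 7 * F 8 9 - F 7 9 * F 8 7) * (F 9 8 * F 10 10 - F 9 10 * F 10 8)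
   + (F 7 7 * F 8 10 - F 7 10 * F 8 7) * (F 9 8 * F 10 9 - F 9 9 * F 10 8)
   + (F 7 8 * F 8 9 - F 7 9 * F 8 8) * (F 9 7 * F 10 10 - F 9 10 * F 10 7)
   - (F 7 8 * F 8 10 - F 7 10 * F 8 8) * (F 9 7 * F 10 9 - F 9 9 * F 10 7)
   + (F 7 9 * F 8 10 - F 7 10 * F 8 9) * (F 9 7 * F 10 8 - F 9 8 * F 10 7)"
proof -
  have f: "finite {8,9,10::10}" "7 \<notin> {8,9,10::10}" "finite {9,10::10}" "8 \<notin> {9,10::10}" 
     "finite {10::10}" "9 \<notin> {10::10}" by simp_all
  show ?thesis
    unfolding sum_over_permutations_insert[OF f(1,2)]
    unfolding sum_over_permutations_insert[OF f(3,4)]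
    unfolding sum_over_permutations_insert[OF f(5,6)]
    unfolding permutes_sing
    by (simp add: sign_swap_id permutation_swap_id permutation_compose sign_compose swap_id_eq
        algebra_simps)
qed

text \<open>The Laplace expansion of the \<open>4 \<times> 4\<close> determinant with rows \<open>y, z, uy, uz\<close> and columns \<open>i, j, k, l\<close>:
a pair of columns contributes \<open>(u\<^sub>j - u\<^sub>i) y\<^sub>i y\<^sub>j\<close> to the rows \<open>y, uy\<close>, and the complementary pair the
corresponding minor of the rows \<open>z, uz\<close>.\<close>

definition Q4 :: "('m \<Rightarrow> 'a::comm_ring_1) \<Rightarrow> ('m \<Rightarrow> 'a) \<Rightarrow> ('m \<Rightarrow> 'a) \<Rightarrow> 'm \<Rightarrow> 'm \<Rightarrow> 'm \<Rightarrow> 'm \<Rightarrow> 'a" where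
  "Q4 u y z i j k l =
     (u j - u i) * (u l - u k) * (y i * y j * z k * z l + z i * z j * y k * y l)
   - (u k - u i) * (u l - u j) * (y i * y k * z j * z l + z i * z k * y j * y l)
   + (u l - u i) * (u k - u j) * (y i * y l * z j * z k + z i * z l * y j * y k)"

lemma Q4_leibniz:
  fixes U y z :: "'m \<Rightarrow> 'a::comm_ring_1"
  assumes "a = - (U i * z i)" "b = U i * y i" "c = z i" "d = - y i"
    "e = - (U j * z j)" "f = U j * y j" "g = z j" "h = - y j"
    "i' = - (U k * z k)" "j' = U k * y k" "k' = z k" "l' = - y k"
    "m = - (U l * z l)" "n = U l * y l" "q = z l" "p = - y l"
  shows "(a * f - b * e) * (k' * p - l' * q) -
     (a * g - c * e) * (j' * p - l' * n) +
     (a * h - d * e) * (j' * q - k' * n) +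
     (b * g - c * f) * (i' * p - l' * m) -
     (b * h - d * f) * (i' * q - k' * m) +
     (c * h - d * g) * (i' * n - j' * m) = - Q4 U y z i j k l"
  unfolding assms Q4_def by (simp add: algebra_simps)

text \<open>A quadric through the three common points with \<open>y = z = 0\<close> has no monomials \<open>x\<^sup>2, w\<^sup>2, xw\<close>, and one
through the three common points with \<open>x = w = 0\<close> has no monomials \<open>y\<^sup>2, z\<^sup>2, yz\<close>. The determinant
therefore reduces to the coordinates \<open>xy, xz, yw, zw\<close> of the last four points, which are
\<open>-uz, uy, z, -y\<close> at \<open>e_point u i\<close>.\<close>

lemma det_Phi:
  fixes u :: "complex ^ 'm::{finite,linorder}"
  shows "det (Phi u (i, j, k, l)) \<in> {Q4 (\<lambda>i. Const (u $ i)) (Var 2) (Var 3) i j k l, - Q4 (\<lambda>i. Const (u $ i)) (Var 2) (Var 3) i j k l}"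
proof -
  define A where "A = transpose (Phi u (i, j, k, l))"
  \<comment> \<open>This order of the monomials makes the six rows of the common points unitriangular.\<close>
  define s :: "10 \<Rightarrow> 10" where
    "s = Transposition.transpose 2 4 \<circ> Transposition.transpose 6 8 \<circ>
      (Transposition.transpose 3 7 \<circ> Transposition.transpose 5 7)"
  have s: "s 1 = 1" "s 2 = 4" "s 3 = 7" "s 4 = 2" "s 5 = 3" "s 6 = 8" "s 7 = 5" "s 8 = 6" "s 9 = 9" "s 10 = 10"
    by (simp_all add: s_def Transposition.transpose_def)
  have sp: "s permutes UNIV"
    unfolding s_def by (intro permutes_compose permutes_swap_id) auto
  define B where "B = (\<chi> r c. A $ r $ s c)"
  have A: "A = vector
     [nu (vector [1, 0, 0, 0]), nu (vector [0, 0, 0, 1]), nu (vector [1, 0, 0, 1]),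
      nu (vector [0, 1, 0, 0]), nu (vector [0, 0, 1, 0]), nu (vector [0, 1, 1, 0]),
      nu (e_point u i), nu (e_point u j), nu (e_point u k), nu (e_point u l)]"
    by (simp add: A_def Phi_def transpose_def vec_eq_iff)
  have B: "B $ r $ c = A $ r $ s c" for r c by (simp add: B_def)
  have "det B = (\<Sum>p\<in>{p. p permutes {7, 8, 9, 10}}. of_int (sign p) * (\<Prod>i\<in>{7,8,9,10}. B $ i $ p i))"
  proof (rule det_forced_diagonal)
    fix p :: "10 \<Rightarrow> 10"
    assume p: "p permutes UNIV" and nz: "\<forall>i. B $ i $ p i \<noteq> 0"
    have inj: "p a = p b \<longleftrightarrow> a = b" for a b
      using p by (metis permutes_inj injD)
    have 1: "B $ 1 $ c \<noteq> 0 \<longrightarrow> c = 1" "B $ 2 $ c \<noteq> 0 \<longrightarrow> c = 2"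
      "B $ 3 $ c \<noteq> 0 \<longrightarrow> c = 1 \<or> c = 2 \<or> c = 3" "B $ 4 $ c \<noteq> 0 \<longrightarrow> c = 4"
      "B $ 5 $ c \<noteq> 0 \<longrightarrow> c = 5" "B $ 6 $ c \<noteq> 0 \<longrightarrow> c = 4 \<or> c = 5 \<or> c = 6" for c
      using exhaust_10[of c] by (auto simp: B A s vector_10 nu_nth vector_4)
    have p1: "p 1 = 1" "p 2 = 2" "p 4 = 4" "p 5 = 5" using nz 1 by blast+
    have p3: "p 3 = 3" using 1(3)[of "p 3"] nz inj[of 3 1] inj[of 3 2] p1 by auto
    have p6: "p 6 = 6" using 1(6)[of "p 6"] nz inj[of 6 4] inj[of 6 5] p1 by auto
    show "\<forall>i\<in>- {7, 8, 9, 10}. p i = i"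
    proof
      fix i :: 10 assume "i \<in> - {7, 8, 9, 10}"
      then show "p i = i" using exhaust_10[of i] p1 p3 p6 by auto
    qed
  next
    fix i :: 10 assume "i \<notin> {7, 8, 9, 10}"
    then show "B $ i $ i = 1"
      using exhaust_10[of i] by (auto simp: B A s vector_10 nu_nth vector_4)
  qed
  also have "\<dots> = - Q4 (\<lambda>i. Const (u $ i)) (Var 2) (Var 3) i j k l"
    unfolding sum_permutes_4[of "\<lambda>r c. B $ r $ c"]
    by (rule Q4_leibniz) (simp_all add: B A s vector_10 nu_nth vector_4 e_point_def)
  finally have detB: "det B = - Q4 (\<lambda>i. Const (u $ i)) (Var 2) (Var 3) i j k l" .
  have "det B = of_int (sign s) * det A"
    unfolding B_def by (rule det_permute_columns[OF sp])
  moreover have "sign s = 1 \<or> sign s = -1" by (simp add: sign_def)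
  ultimately have "det A = det B \<or> det A = - det B" by auto
  then show ?thesis using detB by (auto simp: A_def)
qed

section \<open>Evaluation of polynomials\<close>

definition monomial_value :: "((3 \<times> 'm::finite) \<Rightarrow>\<^sub>0 nat) \<Rightarrow> complex ^ 3 ^ 'm \<Rightarrow> complex" where
  "monomial_value t l = (\<Prod>(i, j)\<in>UNIV. (l $ j $ i) ^ Poly_Mapping.lookup t (i, j))"

lemma monomial_value_zero [simp]: "monomial_value 0 l = 1"
  by (simp add: monomial_value_def case_prod_unfold)

lemma monomial_value_add: "monomial_value (s + t) l = monomial_value s l * monomial_value t l"
  by (simp add: monomial_value_def case_prod_unfold lookup_add power_add prod.distrib)

lemma monomial_value_single [simp]:
  "monomial_value (Poly_Mapping.single (i, j) (Suc 0)) l = l $ j $ i"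
proof -
  have "monomial_value (Poly_Mapping.single (i, j) (Suc 0)) l
      = (\<Prod>p\<in>UNIV. if p = (i, j) then l $ j $ i else 1)"
    unfolding monomial_value_def case_prod_unfold
    by (intro prod.cong) (auto simp: lookup_single when_def)
  then show ?thesis by simp
qed

lemma monomial_value_eq_0_iff:
  "monomial_value t l = 0 \<longleftrightarrow> (\<exists>i j. Poly_Mapping.lookup t (i, j) \<noteq> 0 \<and> l $ j $ i = 0)"
  by (auto simp: monomial_value_def case_prod_unfold)

lemma eval_lpoly_superset:
  assumes "finite F" "Poly_Mapping.keys p \<subseteq> F"
  shows "eval_lpoly p l = (\<Sum>t\<in>F. Poly_Mapping.lookup p t * monomial_value t l)"
  unfolding eval_lpoly_def monomial_value_def[symmetric]
  using assms by (intro sum.mono_neutral_left) (auto simp: in_keys_iff)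

lemma lpoly_eq_sum_single:
  "p = (\<Sum>t\<in>Poly_Mapping.keys p. Poly_Mapping.single t (Poly_Mapping.lookup p t))"
  by (intro poly_mapping_eqI)
    (auto simp: lookup_sum lookup_single when_def in_keys_iff)

lemma lpoly_induct [case_names zero single add]:
  fixes p :: "'t \<Rightarrow>\<^sub>0 complex"
  assumes "P 0" "\<And>t c. P (Poly_Mapping.single t c)" "\<And>p q. P p \<Longrightarrow> P q \<Longrightarrow> P (p + q)"
  shows "P p"
proof -
  have "P (\<Sum>t\<in>F. Poly_Mapping.single t (Poly_Mapping.lookup p t))" if "finite F" for F
    using that by induction (auto intro: assms)
  then show ?thesis
    by (metis lpoly_eq_sum_single finite_keys)
qed

lemma eval_lpoly_zero [simp]: "eval_lpoly 0 l = 0"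
  by (simp add: eval_lpoly_def)

lemma eval_lpoly_single: "eval_lpoly (Poly_Mapping.single t c) l = c * monomial_value t l"
  by (subst eval_lpoly_superset[of "{t}"]) auto

lemma eval_lpoly_add [simp]: "eval_lpoly (p + q) l = eval_lpoly p l + eval_lpoly q l"
proof -
  define F where "F = Poly_Mapping.keys p \<union> Poly_Mapping.keys q"
  have F: "finite F" "Poly_Mapping.keys p \<subseteq> F" "Poly_Mapping.keys q \<subseteq> F"
    "Poly_Mapping.keys (p + q) \<subseteq> F"
    using keys_add[of p q] by (auto simp: F_def)
  show ?thesis
    using F by (simp add: eval_lpoly_superset[of F] lookup_add sum.distrib distrib_right)
qed

lemma eval_lpoly_uminus [simp]: "eval_lpoly (- p) l = - eval_lpoly p l"
  using eval_lpoly_add[of p "- p" l] by (simp add: eq_neg_iff_add_eq_0 add.commute)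

lemma eval_lpoly_diff [simp]: "eval_lpoly (p - q) l = eval_lpoly p l - eval_lpoly q l"
  using eval_lpoly_add[of p "- q" l] by simp

lemma eval_lpoly_mult [simp]: "eval_lpoly (p * q) l = eval_lpoly p l * eval_lpoly q l"
proof (induction p rule: lpoly_induct)
  case (single s c)
  show ?case
  proof (induction q rule: lpoly_induct)
    case (single t d)
    then show ?case
      by (simp add: mult_single eval_lpoly_single monomial_value_add)
  qed (simp_all add: distrib_left)
qed (simp_all add: distrib_right)

lemma eval_lpoly_Const [simp]: "eval_lpoly (Const c) l = c"
  by (simp add: Const_def eval_lpoly_single)

lemma eval_lpoly_Var [simp]: "eval_lpoly (Var i j) l = l $ j $ i"
  by (simp add: Var_def eval_lpoly_single)

lemma Const_add: "Const (a + b) = Const a + Const b"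
  by (simp add: Const_def single_add)

lemma Const_diff: "Const (a - b) = Const a - Const b"
  by (simp add: Const_def single_diff)

lemma Const_mult: "Const (a * b) = Const a * Const b"
  by (simp add: Const_def mult_single)

lemma Const_1 [simp]: "Const 1 = 1" and Const_0 [simp]: "Const 0 = 0"
  by (simp_all add: Const_def)

section \<open>The fine grading\<close>

text \<open>The grading by the degrees in the single cameras and in the single letters \<open>x, y, z\<close>. It
is finer than the multigrading and still respected by all ideals below, and its components correspond
to the scalings \<open>l\<^sub>i\<^sub>j \<mapsto> s\<^sub>j r\<^sub>i l\<^sub>i\<^sub>j\<close>. A degree is represented by any exponent that has it.\<close>

definition colsum :: "((3 \<times> 'm::finite) \<Rightarrow>\<^sub>0 nat) \<Rightarrow> 'm \<Rightarrow> nat" where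
  "colsum t j = (\<Sum>i\<in>UNIV. Poly_Mapping.lookup t (i, j))"

definition rowsum :: "((3 \<times> 'm::finite) \<Rightarrow>\<^sub>0 nat) \<Rightarrow> 3 \<Rightarrow> nat" where
  "rowsum t i = (\<Sum>j\<in>UNIV. Poly_Mapping.lookup t (i, j))"

definition same_degree :: "((3 \<times> 'm::finite) \<Rightarrow>\<^sub>0 nat) \<Rightarrow> ((3 \<times> 'm) \<Rightarrow>\<^sub>0 nat) \<Rightarrow> bool" where
  "same_degree s t \<longleftrightarrow> colsum s = colsum t \<and> rowsum s = rowsum t"

definition component_space :: "((3 \<times> 'm::finite) \<Rightarrow>\<^sub>0 nat) \<Rightarrow> 'm lpoly set" where
  "component_space t0 = {p. \<forall>t\<in>Poly_Mapping.keys p. same_degree t t0}"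

definition component :: "((3 \<times> 'm::finite) \<Rightarrow>\<^sub>0 nat) \<Rightarrow> 'm lpoly \<Rightarrow> 'm lpoly" where
  "component t0 p = Poly_Mapping.mapp (\<lambda>t c. c when same_degree t t0) p"

definition homogeneous :: "'m::finite lpoly \<Rightarrow> bool" where
  "homogeneous p \<longleftrightarrow> (\<exists>t. p \<in> component_space t)"

definition total_degree :: "((3 \<times> 'm::finite) \<Rightarrow>\<^sub>0 nat) \<Rightarrow> nat" where
  "total_degree t = (\<Sum>j\<in>UNIV. colsum t j)"

lemma colsum_add: "colsum (s + t) j = colsum s j + colsum t j"
  and rowsum_add: "rowsum (s + t) i = rowsum s i + rowsum t i"
  by (simp_all add: colsum_def rowsum_def lookup_add sum.distrib)

lemma colsum_single: "colsum (Poly_Mapping.single (i, j) n) k = (if k = j then n else 0)"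
proof -
  have "colsum (Poly_Mapping.single (i, j) n) k
      = (\<Sum>i'\<in>UNIV. if i' = i then (if k = j then n else 0) else 0)"
    unfolding colsum_def by (intro sum.cong) (auto simp: lookup_single when_def)
  then show ?thesis by simp
qed

lemma rowsum_single: "rowsum (Poly_Mapping.single (i, j) n) k = (if k = i then n else 0)"
proof -
  have "rowsum (Poly_Mapping.single (i, j) n) k
      = (\<Sum>j'\<in>UNIV. if j' = j then (if k = i then n else 0) else 0)"
    unfolding rowsum_def by (intro sum.cong) (auto simp: lookup_single when_def)
  then show ?thesis by simp
qed

lemma total_degree_add: "total_degree (s + t) = total_degree s + total_degree t"
  by (simp add: total_degree_def colsum_add sum.distrib)

lemma total_degree_single [simp]: "total_degree (Poly_Mapping.single (i, j) n) = n"
  by (simp add: total_degree_def colsum_single)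

lemma same_degree_refl [simp]: "same_degree t t"
  by (simp add: same_degree_def)

lemma same_degree_sym: "same_degree s t \<Longrightarrow> same_degree t s"
  by (simp add: same_degree_def)

lemma same_degree_trans [trans]: "same_degree r s \<Longrightarrow> same_degree s t \<Longrightarrow> same_degree r t"
  by (simp add: same_degree_def)

lemma same_degree_add: "same_degree s t \<Longrightarrow> same_degree s' t' \<Longrightarrow> same_degree (s + s') (t + t')"
  by (simp add: same_degree_def fun_eq_iff colsum_add rowsum_add)

lemma same_degree_cancel: "same_degree (r + s) (r + t) \<Longrightarrow> same_degree s t"
  by (simp add: same_degree_def fun_eq_iff colsum_add rowsum_add)

lemma same_degree_total_degree: "same_degree s t \<Longrightarrow> total_degree s = total_degree t"
  by (simp add: same_degree_def total_degree_def)

lemma component_space_cong: "same_degree s t \<Longrightarrow> component_space s = component_space t"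
  unfolding component_space_def by (metis same_degree_sym same_degree_trans)

lemma component_space_add:
  "p \<in> component_space t \<Longrightarrow> q \<in> component_space t \<Longrightarrow> p + q \<in> component_space t"
  using keys_add[of p q] by (auto simp: component_space_def)

lemma component_space_uminus: "p \<in> component_space t \<Longrightarrow> - p \<in> component_space t"
  by (auto simp: component_space_def in_keys_iff)

lemma component_space_diff:
  "p \<in> component_space t \<Longrightarrow> q \<in> component_space t \<Longrightarrow> p - q \<in> component_space t"
  using component_space_add[of p t "- q"] component_space_uminus[of q t] by simp

lemma component_space_mult:
  "p \<in> component_space s \<Longrightarrow> q \<in> component_space t \<Longrightarrow> p * q \<in> component_space (s + t)"
  using keys_mult[of p q] by (fastforce simp: component_space_def intro: same_degree_add)

lemma single_in_component_space: "Poly_Mapping.single t c \<in> component_space t"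
  by (auto simp: component_space_def)

lemma Const_in_component_space: "Const c \<in> component_space 0"
  unfolding Const_def by (rule single_in_component_space)

lemma Var_in_component_space: "Var i j \<in> component_space (Poly_Mapping.single (i, j) 1)"
  unfolding Var_def by (rule single_in_component_space)

lemma lookup_component:
  "Poly_Mapping.lookup (component t0 p) t = (if same_degree t t0 then Poly_Mapping.lookup p t else 0)"
  by (auto simp: component_def lookup_mapp when_def in_keys_iff)

lemma component_in_space: "component t0 p \<in> component_space t0"
  by (auto simp: component_space_def in_keys_iff lookup_component split: if_splits)

lemma component_add: "component t0 (p + q) = component t0 p + component t0 q"
  by (intro poly_mapping_eqI) (simp add: lookup_component lookup_add)

lemma component_diff: "component t0 (p - q) = component t0 p - component t0 q"
  by (intro poly_mapping_eqI) (simp add: lookup_component lookup_minus)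

lemma component_zero [simp]: "component t0 0 = 0"
  by (intro poly_mapping_eqI) (simp add: lookup_component)

lemma component_of_member: "p \<in> component_space t0 \<Longrightarrow> component t0 p = p"
  by (intro poly_mapping_eqI)
    (auto simp: lookup_component component_space_def in_keys_iff)

lemma component_of_nonmember:
  assumes "p \<in> component_space s" "\<not> same_degree s t0" shows "component t0 p = 0"
proof (intro poly_mapping_eqI)
  fix t
  have "\<not> same_degree t t0" if "t \<in> Poly_Mapping.keys p"
    using that assms same_degree_trans[OF same_degree_sym, of t s t0] by (auto simp: component_space_def)
  then show "Poly_Mapping.lookup (component t0 p) t = Poly_Mapping.lookup 0 t"
    by (auto simp: lookup_component in_keys_iff)
qed

text \<open>Multiplication by a homogeneous \<open>a\<close> shifts degrees, so a component of a multiple of \<open>a\<close> is again a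
multiple of \<open>a\<close>. The cofactor vanishes if no exponent has the required degree, so the lemma
only asserts that it exists.\<close>

lemma component_mult:
  assumes "a \<in> component_space s"
  shows "\<exists>k'. component t0 (k * a) = k' * a"
proof (induction k rule: lpoly_induct)
  case zero
  show ?case by (rule exI[of _ 0]) simp
next
  case (single t c)
  have "Poly_Mapping.single t c * a \<in> component_space (t + s)"
    by (intro component_space_mult single_in_component_space assms)
  then have "component t0 (Poly_Mapping.single t c * a)
      = (if same_degree (t + s) t0 then Poly_Mapping.single t c else 0) * a"
    using component_space_cong[of "t + s" t0]
    by (auto simp: component_of_member component_of_nonmember)
  then show ?case by blast
next
  case (add p q)
  then obtain k1 k2 where "component t0 (p * a) = k1 * a" "component t0 (q * a) = k2 * a"
    by blast
  then have "component t0 ((p + q) * a) = (k1 + k2) * a"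
    by (simp add: distrib_right component_add)
  then show ?case by blast
qed

lemma component_in_span:
  assumes "\<forall>g\<in>G. homogeneous g" "x \<in> ideal.span G"
  shows "component t0 x \<in> ideal.span G"
  using assms(2)
proof (induction rule: ideal.span_induct_alt)
  case base
  show ?case by (simp add: ideal.span_zero)
next
  case (step c g y)
  obtain k where "component t0 (c * g) = k * g"
    using assms(1) step(1) component_mult unfolding homogeneous_def by blast
  then show ?case
    using step by (simp add: component_add ideal.span_add ideal.span_scale ideal.span_base)
qed

text \<open>Working modulo one more homogeneous generator \<open>v\<close> produces a multiple of \<open>v\<close>; taking components keeps
that multiple in the degree of \<open>x\<close>, which makes induction on the degree possible.\<close>

lemma homogeneous_span_insert:
  assumes "\<forall>g\<in>G. homogeneous g" "homogeneous v" "x \<in> component_space t0"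
    and "x \<in> ideal.span (insert v G)"
  obtains q where "v * q \<in> component_space t0" "x - v * q \<in> ideal.span G"
proof -
  obtain k where k: "x - k * v \<in> ideal.span G"
    using assms(4) by (auto simp: ideal.span_breakdown_eq)
  obtain k' where k': "component t0 (k * v) = k' * v"
    using assms(2) component_mult unfolding homogeneous_def by blast
  have "x - k' * v \<in> ideal.span G"
    using component_in_span[OF assms(1) k, of t0] k' component_of_member[OF assms(3)]
    by (simp add: component_diff)
  moreover have "k' * v \<in> component_space t0"
    using component_in_space[of t0 "k * v"] k' by simp
  ultimately show ?thesis using that[of k'] by (simp add: mult.commute)
qed

lemma lookup_single_times:
  fixes q :: "'m::finite lpoly"
  shows "Poly_Mapping.lookup (Poly_Mapping.single s 1 * q) (s + t) = Poly_Mapping.lookup q t"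
proof (induction q rule: lpoly_induct)
  case (single t' c)
  then show ?case by (auto simp: mult_single lookup_single when_def)
qed (simp_all add: lookup_add distrib_left)

lemma component_space_quotient:
  fixes q :: "'m::finite lpoly"
  assumes "Poly_Mapping.single s 1 * q \<in> component_space t0" "q \<noteq> 0"
  obtains t1 where "q \<in> component_space t1" "same_degree (s + t1) t0"
proof -
  have *: "same_degree (s + t) t0" if "t \<in> Poly_Mapping.keys q" for t
  proof -
    have "s + t \<in> Poly_Mapping.keys (Poly_Mapping.single s 1 * q)"
      using that by (metis in_keys_iff lookup_single_times)
    then show ?thesis using assms(1) by (auto simp: component_space_def)
  qed
  obtain t1 where t1: "t1 \<in> Poly_Mapping.keys q"
    using assms(2) by (metis keys_eq_empty all_not_in_conv)
  have "q \<in> component_space t1"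
    unfolding component_space_def
    using same_degree_cancel[OF same_degree_trans[OF * same_degree_sym[OF *[OF t1]]]] by blast
  then show ?thesis using that *[OF t1] by blast
qed

section \<open>Separation of components by scaling\<close>

lemma power_sum_zero_imp_coefficients_zero:
  fixes c :: "'t \<Rightarrow> complex" and w :: "'t \<Rightarrow> nat"
  assumes F: "finite F" and z: "\<And>x. x \<noteq> 0 \<Longrightarrow> (\<Sum>t\<in>F. c t * x ^ w t) = 0"
  shows "(\<Sum>t\<in>{t\<in>F. w t = d}. c t) = 0"
proof (cases "d \<in> w ` F")
  case True
  define N where "N = Max (w ` F)"
  define C where "C i = (\<Sum>t\<in>{t\<in>F. w t = i}. c t)" for i
  have eq: "(\<Sum>t\<in>F. c t * x ^ w t) = (\<Sum>i\<le>N. C i * x ^ i)" for x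
  proof -
    have "(\<Sum>t\<in>F. c t * x ^ w t) = (\<Sum>i\<le>N. \<Sum>t\<in>{t\<in>F. w t = i}. c t * x ^ w t)"
      using F by (intro sum.group[symmetric]) (auto simp: N_def)
    then show ?thesis by (simp add: C_def sum_distrib_right)
  qed
  have "infinite (- {0 :: complex})"
    by (simp add: Compl_eq_Diff_UNIV infinite_UNIV_char_0)
  moreover have "- {0} \<subseteq> {x. (\<Sum>i\<le>N. C i * x ^ i) = 0}"
    using z eq by auto
  ultimately have "infinite {x. (\<Sum>i\<le>N. C i * x ^ i) = 0}"
    using finite_subset by blast
  moreover have "d \<le> N" using True F by (auto simp: N_def)
  ultimately have "C d = 0" using polyfun_finite_roots[of C N] by blast
  then show ?thesis by (simp add: C_def)
next
  case False
  then show ?thesis by (metis (mono_tags, lifting) Collect_empty_eq image_eqI sum.empty)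
qed

text \<open>Independence of the characters \<open>x \<mapsto> \<Prod>k. x\<^sub>k\<^bsup>w k t\<^esup>\<close> of a torus, one variable at a time.\<close>

lemma character_sum_zero_imp_coefficients_zero:
  fixes c :: "'t \<Rightarrow> complex" and w :: "'k \<Rightarrow> 't \<Rightarrow> nat"
  assumes "finite K" "finite F"
    and "\<And>x. (\<And>k. x k \<noteq> 0) \<Longrightarrow> (\<Sum>t\<in>F. c t * (\<Prod>k\<in>K. x k ^ w k t)) = 0"
  shows "(\<Sum>t\<in>{t\<in>F. \<forall>k\<in>K. w k t = d k}. c t) = 0"
  using assms
proof (induction K arbitrary: F rule: finite_induct)
  case empty
  then show ?case using empty(2)[of "\<lambda>_. 1"] by simp
next
  case (insert k K)
  have "(\<Sum>t\<in>{t\<in>F. w k t = d k}. c t * (\<Prod>k\<in>K. x k ^ w k t)) = 0"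
    if x: "\<And>k. x k \<noteq> 0" for x :: "'k \<Rightarrow> complex"
  proof (rule power_sum_zero_imp_coefficients_zero[OF insert.prems(1)])
    fix y :: complex assume "y \<noteq> 0"
    then have "(\<Sum>t\<in>F. c t * (\<Prod>i\<in>insert k K. (x(k := y)) i ^ w i t)) = 0"
      using x by (intro insert.prems(2)) auto
    moreover have "(\<Prod>i\<in>insert k K. (x(k := y)) i ^ w i t) = (\<Prod>k\<in>K. x k ^ w k t) * y ^ w k t" for t
    proof -
      have "(\<Prod>i\<in>K. (x(k := y)) i ^ w i t) = (\<Prod>k\<in>K. x k ^ w k t)"
        using insert.hyps by (intro prod.cong) auto
      then show ?thesis using insert.hyps by simp
    qed
    ultimately show "(\<Sum>t\<in>F. c t * (\<Prod>k\<in>K. x k ^ w k t) * y ^ w k t) = 0"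
      by (simp only: mult.assoc)
  qed
  then have "(\<Sum>t\<in>{t \<in> {t\<in>F. w k t = d k}. \<forall>k\<in>K. w k t = d k}. c t) = 0"
    using insert.IH[of "{t\<in>F. w k t = d k}"] insert.prems(1) by simp
  moreover have "{t \<in> {t\<in>F. w k t = d k}. \<forall>k\<in>K. w k t = d k}
      = {t\<in>F. \<forall>k\<in>insert k K. w k t = d k}" by auto
  ultimately show ?case by simp
qed

lemma monomial_value_scale:
  fixes l :: "complex ^ 3 ^ 'm::finite"
  shows "monomial_value t (\<chi> j i. x j * y i * l $ j $ i)
    = monomial_value t l * (\<Prod>i\<in>UNIV. y i ^ rowsum t i) * (\<Prod>j\<in>UNIV. x j ^ colsum t j)"
proof -
  have "monomial_value t (\<chi> j i. x j * y i * l $ j $ i)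
    = (\<Prod>(i, j)\<in>UNIV. x j ^ Poly_Mapping.lookup t (i, j)) *
      (\<Prod>(i, j)\<in>UNIV. y i ^ Poly_Mapping.lookup t (i, j)) * monomial_value t l"
    by (simp add: monomial_value_def case_prod_unfold power_mult_distrib prod.distrib)
  moreover have "(\<Prod>(i, j)\<in>(UNIV :: (3 \<times> 'm) set). y i ^ Poly_Mapping.lookup t (i, j))
      = (\<Prod>i\<in>UNIV. y i ^ rowsum t i)"
    by (simp add: rowsum_def power_sum prod.cartesian_product flip: UNIV_Times_UNIV)
  moreover have "(\<Prod>(i, j)\<in>(UNIV :: (3 \<times> 'm) set). x j ^ Poly_Mapping.lookup t (i, j))
      = (\<Prod>j\<in>UNIV. x j ^ colsum t j)"
    unfolding colsum_def power_sum
    by (subst prod.swap) (simp add: prod.cartesian_product flip: UNIV_Times_UNIV)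
  ultimately show ?thesis by (simp only: mult_ac)
qed

text \<open>A polynomial that vanishes on the torus orbit of a point has all components vanishing at that point.\<close>

lemma eval_component_eq_zero:
  fixes l :: "complex ^ 3 ^ 'm::finite"
  assumes "\<And>x y. (\<And>j. x j \<noteq> 0) \<Longrightarrow> (\<And>i. y i \<noteq> 0) \<Longrightarrow>
    eval_lpoly p (\<chi> j i. x j * y i * l $ j $ i) = 0"
  shows "eval_lpoly (component t0 p) l = 0"
proof -
  let ?F = "Poly_Mapping.keys p"
  let ?c = "\<lambda>t. Poly_Mapping.lookup p t * monomial_value t l"
  have "(\<Sum>t\<in>{t\<in>?F. \<forall>j\<in>UNIV. colsum t j = colsum t0 j}.
      ?c t * (\<Prod>i\<in>UNIV. y i ^ rowsum t i)) = 0"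
    if y: "\<And>i. y i \<noteq> 0" for y :: "3 \<Rightarrow> complex"
  proof (rule character_sum_zero_imp_coefficients_zero[where w = "\<lambda>j t. colsum t j"
        and c = "\<lambda>t. ?c t * (\<Prod>i\<in>UNIV. y i ^ rowsum t i)" and d = "colsum t0"])
    fix x :: "'m \<Rightarrow> complex" assume x: "\<And>j. x j \<noteq> 0"
    show "(\<Sum>t\<in>?F. ?c t * (\<Prod>i\<in>UNIV. y i ^ rowsum t i) * (\<Prod>j\<in>UNIV. x j ^ colsum t j)) = 0"
      using assms[of x y, OF x y]
      unfolding eval_lpoly_superset[OF finite_keys subset_refl] monomial_value_scale
      by (simp only: mult.assoc)
  qed simp_all
  then have "(\<Sum>t\<in>{t \<in> {t\<in>?F. \<forall>j\<in>UNIV. colsum t j = colsum t0 j}.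
      \<forall>i\<in>UNIV. rowsum t i = rowsum t0 i}. ?c t) = 0"
    by (intro character_sum_zero_imp_coefficients_zero[where w = "\<lambda>i t. rowsum t i"
        and c = ?c and d = "rowsum t0"]) simp_all
  moreover have "{t \<in> {t\<in>?F. \<forall>j\<in>UNIV. colsum t j = colsum t0 j}.
      \<forall>i\<in>UNIV. rowsum t i = rowsum t0 i} = {t\<in>?F. same_degree t t0}"
    by (auto simp: same_degree_def fun_eq_iff)
  moreover have "eval_lpoly (component t0 p) l = (\<Sum>t\<in>{t\<in>?F. same_degree t t0}. ?c t)"
    by (subst eval_lpoly_superset[of "{t\<in>?F. same_degree t t0}"])
      (auto simp: in_keys_iff lookup_component split: if_splits)
  ultimately show ?thesis by simp
qed

section \<open>Explicit generators\<close>

text \<open>The determinant with rows \<open>a, b, c\<close> and columns \<open>i, j, k\<close>.\<close>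

definition det3 :: "('m \<Rightarrow> 'a::comm_ring_1) \<Rightarrow> ('m \<Rightarrow> 'a) \<Rightarrow> ('m \<Rightarrow> 'a) \<Rightarrow> 'm \<Rightarrow> 'm \<Rightarrow> 'm \<Rightarrow> 'a" where
  "det3 a b c i j k = a i * (b j * c k - b k * c j) - a j * (b i * c k - b k * c i)
     + a k * (b i * c j - b j * c i)"

text \<open>Arbitrary columns are allowed, in any order and with repetitions; up to sign this adds only zero.\<close>

definition generators :: "complex ^ 'm \<Rightarrow> 'm lpoly set" where
  "generators u = (let U = (\<lambda>j. Const (u $ j)); V = (\<lambda>j. U j * Var 1 j) in
     {det3 (Var 1) V (Var 2) i j k | i j k. True} \<union> {det3 (Var 1) V (Var 3) i j k | i j k. True} \<union>
     {det3 (Var 1) (Var 2) (Var 3) i j k | i j k. True} \<union> {det3 V (Var 2) (Var 3) i j k | i j k. True} \<union>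
     {Q4 U (Var 2) (Var 3) i j k l | i j k l. True})"

lemma generators_cases:
  assumes "g \<in> generators u"
  obtains i j k where "g = det3 (Var 1) (\<lambda>j. Const (u $ j) * Var 1 j) (Var 2) i j k"
  | i j k where "g = det3 (Var 1) (\<lambda>j. Const (u $ j) * Var 1 j) (Var 3) i j k"
  | i j k where "g = det3 (Var 1) (Var 2) (Var 3) i j k"
  | i j k where "g = det3 (\<lambda>j. Const (u $ j) * Var 1 j) (Var 2) (Var 3) i j k"
  | i j k l where "g = Q4 (\<lambda>j. Const (u $ j)) (Var 2) (Var 3) i j k l"
  using assms unfolding generators_def Let_def by blast

lemma generatorsI:
  "det3 (Var 1) (\<lambda>j. Const (u $ j) * Var 1 j) (Var 2) i j k \<in> generators u"
  "det3 (Var 1) (\<lambda>j. Const (u $ j) * Var 1 j) (Var 3) i j k \<in> generators u"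
  "det3 (Var 1) (Var 2) (Var 3) i j k \<in> generators u"
  "det3 (\<lambda>j. Const (u $ j) * Var 1 j) (Var 2) (Var 3) i j k \<in> generators u"
  "Q4 (\<lambda>j. Const (u $ j)) (Var 2) (Var 3) i j k l \<in> generators u"
  unfolding generators_def Let_def by blast+

abbreviation unit_exp :: "3 \<Rightarrow> 'm \<Rightarrow> (3 \<times> 'm) \<Rightarrow>\<^sub>0 nat" where
  "unit_exp i j \<equiv> Poly_Mapping.single (i, j) 1"

abbreviation mon :: "((3 \<times> 'm) \<Rightarrow>\<^sub>0 nat) \<Rightarrow> 'm lpoly" where
  "mon t \<equiv> Poly_Mapping.single t 1"

lemma same_degree_unit_swap: "same_degree (unit_exp v j + unit_exp w k) (unit_exp w j + unit_exp v k)"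
  by (simp add: same_degree_def fun_eq_iff colsum_add rowsum_add colsum_single rowsum_single)

lemma Var_scaled_in_component_space: "Const c * Var i j \<in> component_space (unit_exp i j)"
  using component_space_mult[OF Const_in_component_space Var_in_component_space] by simp

lemma det3_homogeneous:
  assumes "\<And>j. a j \<in> component_space (unit_exp \<alpha> j)"
    "\<And>j. b j \<in> component_space (unit_exp \<beta> j)" "\<And>j. c j \<in> component_space (unit_exp \<gamma> j)"
  shows "homogeneous (det3 a b c i j k)"
proof -
  have t: "a p * (b q * c r) \<in> component_space (unit_exp \<alpha> i + (unit_exp \<beta> j + unit_exp \<gamma> k))"
    if "same_degree (unit_exp \<alpha> p + (unit_exp \<beta> q + unit_exp \<gamma> r)) (unit_exp \<alpha> i + (unit_exp \<beta> j + unit_exp \<gamma> k))"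
    for p q r
    using component_space_cong[OF that] component_space_mult[OF assms(1) component_space_mult[OF assms(2,3)]]
    by blast
  have "det3 a b c i j k \<in> component_space (unit_exp \<alpha> i + (unit_exp \<beta> j + unit_exp \<gamma> k))"
    unfolding det3_def right_diff_distrib
    by (intro component_space_add component_space_diff t)
      (simp_all add: same_degree_def fun_eq_iff colsum_add rowsum_add colsum_single rowsum_single)
  then show ?thesis unfolding homogeneous_def by blast
qed

lemma Q4_homogeneous: "homogeneous (Q4 (\<lambda>j. Const (u $ j)) (Var 2) (Var 3) i j k l)"
proof -
  let ?t = "unit_exp 2 i + unit_exp 2 j + unit_exp 3 k + unit_exp 3 l"
  have t: "Var v p * Var w q * Var v' r * Var w' s \<in> component_space ?t"
    if "same_degree (unit_exp v p + unit_exp w q + unit_exp v' r + unit_exp w' s) ?t" for v w v' w' p q r s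
    using component_space_cong[OF that] component_space_mult[OF component_space_mult[OF component_space_mult[OF
      Var_in_component_space Var_in_component_space] Var_in_component_space] Var_in_component_space]
    by blast
  have c: "Const c * p \<in> component_space ?t" if "p \<in> component_space ?t" for c p
    using component_space_mult[OF Const_in_component_space that] by simp
  have "Q4 (\<lambda>j. Const (u $ j)) (Var 2) (Var 3) i j k l \<in> component_space ?t"
    unfolding Q4_def Const_diff[symmetric] Const_mult[symmetric]
    by (intro component_space_add component_space_diff c t)
      (simp_all add: same_degree_def fun_eq_iff colsum_add rowsum_add colsum_single rowsum_single)
  then show ?thesis unfolding homogeneous_def by blast
qed

lemma generators_homogeneous: "\<forall>g\<in>generators u. homogeneous g"
proof
  fix g assume "g \<in> generators u"
  then show "homogeneous g"
  proof (cases rule: generators_cases)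
    case (1 i j k)
    show ?thesis unfolding 1
      by (rule det3_homogeneous) (rule Var_in_component_space Var_scaled_in_component_space)+
  next
    case (2 i j k)
    show ?thesis unfolding 2
      by (rule det3_homogeneous) (rule Var_in_component_space Var_scaled_in_component_space)+
  next
    case (3 i j k)
    show ?thesis unfolding 3
      by (rule det3_homogeneous) (rule Var_in_component_space)+
  next
    case (4 i j k)
    show ?thesis unfolding 4
      by (rule det3_homogeneous) (rule Var_in_component_space Var_scaled_in_component_space)+
  next
    case (5 i j k l)
    show ?thesis unfolding 5 by (rule Q4_homogeneous)
  qed
qed

lemma Var_homogeneous: "homogeneous (Var i j)"
  unfolding homogeneous_def using Var_in_component_space by blast

lemma eval_det3: "eval_lpoly (det3 a b c i j k) l
  = det3 (\<lambda>j. eval_lpoly (a j) l) (\<lambda>j. eval_lpoly (b j) l) (\<lambda>j. eval_lpoly (c j) l) i j k"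
  by (simp add: det3_def)

lemma eval_Q4: "eval_lpoly (Q4 a b c i j k n) l
  = Q4 (\<lambda>j. eval_lpoly (a j) l) (\<lambda>j. eval_lpoly (b j) l) (\<lambda>j. eval_lpoly (c j) l) i j k n"
  by (simp add: Q4_def)

lemma det3_scale:
  fixes s :: "'m \<Rightarrow> 'a::comm_ring_1"
  shows "det3 (\<lambda>j. s j * a j) (\<lambda>j. s j * b j) (\<lambda>j. s j * c j) i j k = s i * s j * s k * det3 a b c i j k"
  unfolding det3_def by (simp add: algebra_simps)

text \<open>The three rows lie in the plane spanned by \<open>s\<close> and \<open>us\<close>.\<close>

lemma det3_affine:
  fixes s u :: "'m \<Rightarrow> complex"
  shows "det3 (\<lambda>j. s j * (A + u j * A')) (\<lambda>j. s j * (B + u j * B')) (\<lambda>j. s j * (C + u j * C')) i j k = 0"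
proof -
  have "det3 (\<lambda>j. A + u j * A') (\<lambda>j. B + u j * B') (\<lambda>j. C + u j * C') i j k = 0"
    unfolding det3_def by algebra
  then show ?thesis by (simp add: det3_scale)
qed

lemma Q4_scale:
  fixes s u :: "'m \<Rightarrow> 'a::comm_ring_1"
  shows "Q4 u (\<lambda>j. s j * y j) (\<lambda>j. s j * z j) i j k l = s i * s j * s k * s l * Q4 u y z i j k l"
  unfolding Q4_def by (simp add: algebra_simps)

text \<open>The four rows \<open>y, z, uy, uz\<close> lie in the space spanned by \<open>s\<close>, \<open>us\<close> and \<open>u\<^sup>2s\<close>.\<close>

lemma Q4_affine:
  fixes s u :: "'m \<Rightarrow> complex"
  shows "Q4 u (\<lambda>j. s j * (B + u j * B')) (\<lambda>j. s j * (C + u j * C')) i j k l = 0"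
proof -
  have "Q4 u (\<lambda>j. B + u j * B') (\<lambda>j. C + u j * C') i j k l = 0"
    unfolding Q4_def by algebra
  then show ?thesis by (simp add: Q4_scale)
qed

section \<open>The parametrised points\<close>

definition line_point :: "complex ^ 'm \<Rightarrow> complex \<Rightarrow> complex \<Rightarrow> complex \<Rightarrow> complex \<Rightarrow> complex ^ 3 ^ 'm" where
  "line_point u b c d e = (\<chi> j. vector [1, b + u $ j * c, d + u $ j * e])"

lemma line_point_nth [simp]:
  "line_point u b c d e $ j $ 1 = 1"
  "line_point u b c d e $ j $ 2 = b + u $ j * c"
  "line_point u b c d e $ j $ 3 = d + u $ j * e"
  by (simp_all add: line_point_def)

lemma generators_vanish:
  assumes "g \<in> generators u"
    and l: "\<And>j. l $ j $ 1 = s j * A" "\<And>j. l $ j $ 2 = s j * (B + u $ j * B')"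
      "\<And>j. l $ j $ 3 = s j * (C + u $ j * C')"
  shows "eval_lpoly g l = 0"
proof -
  have X: "(\<lambda>j. l $ j $ 1) = (\<lambda>j. s j * (A + u $ j * 0))"
    and UX: "(\<lambda>j. u $ j * (l $ j $ 1)) = (\<lambda>j. s j * (0 + u $ j * A))"
    and Y: "(\<lambda>j. l $ j $ 2) = (\<lambda>j. s j * (B + u $ j * B'))"
    and Z: "(\<lambda>j. l $ j $ 3) = (\<lambda>j. s j * (C + u $ j * C'))"
    by (simp_all add: l fun_eq_iff)
  show ?thesis
    using assms(1)
    by (cases rule: generators_cases)
      (simp_all only: eval_det3 eval_Q4 eval_lpoly_mult eval_lpoly_Const eval_lpoly_Var X UX Y Z
        det3_affine[where u = "\<lambda>j. u $ j"] Q4_affine[where u = "\<lambda>j. u $ j"])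
qed

lemma eval_span_eq_zero:
  assumes "\<And>g. g \<in> G \<Longrightarrow> eval_lpoly g l = 0" "p \<in> ideal.span G"
  shows "eval_lpoly p l = 0"
  using assms(2) by (induction rule: ideal.span_induct_alt) (simp_all add: assms(1))

lemma eval_line_point_eq_zero:
  assumes "p \<in> ideal.span (generators u)"
  shows "eval_lpoly p (line_point u b c d e) = 0"
  using assms by (rule eval_span_eq_zero[rotated]) (auto intro!: generators_vanish[where s = "\<lambda>_. 1"])

text \<open>Cancellation of a linear factor on a family of points: evaluation is continuous in the parameter, so
the one parameter at which the factor vanishes does not matter.\<close>

lemma continuous_nonzero_imp_zero:
  fixes f :: "complex \<Rightarrow> complex"
  assumes "continuous_on UNIV f" "\<And>x. (x + k) * f x = 0"
  shows "f x = 0"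
proof -
  have "closed {x. f x = 0}"
    using assms(1) by (intro closed_Collect_eq) auto
  moreover have "- {- k} \<subseteq> {x. f x = 0}"
    using assms(2) by (auto simp: add_eq_0_iff2)
  ultimately have "closure (- {- k}) \<subseteq> {x. f x = 0}"
    by (intro closure_minimal)
  then show ?thesis by (auto simp: closure_complement)
qed

lemma continuous_on_eval_lpoly:
  assumes "\<And>i j. continuous_on UNIV (\<lambda>x. l x $ j $ i)"
  shows "continuous_on UNIV (\<lambda>x. eval_lpoly p (l x))"
  unfolding eval_lpoly_def case_prod_unfold by (intro continuous_intros assms)

lemma continuous_line_point:
  "continuous_on UNIV (\<lambda>b. eval_lpoly p (line_point u b c d e))"
  "continuous_on UNIV (\<lambda>d. eval_lpoly p (line_point u b c d e))"
proof -
  have "continuous_on UNIV (\<lambda>b. line_point u b c d e $ j $ i)"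
    "continuous_on UNIV (\<lambda>d. line_point u b c d e $ j $ i)" for i j
    using exhaust_3[of i] by (elim disjE; simp; intro continuous_intros)+
  then show "continuous_on UNIV (\<lambda>b. eval_lpoly p (line_point u b c d e))"
    "continuous_on UNIV (\<lambda>d. eval_lpoly p (line_point u b c d e))"
    by (auto intro!: continuous_on_eval_lpoly)
qed

lemma cancel_y:
  assumes "\<And>b. (b + k) * eval_lpoly p (line_point u b c d e) = 0"
  shows "eval_lpoly p (line_point u b c d e) = 0"
  using continuous_nonzero_imp_zero[OF continuous_line_point(1) assms] .

lemma cancel_z:
  assumes "\<And>d. (d + k) * eval_lpoly p (line_point u b c d e) = 0"
  shows "eval_lpoly p (line_point u b c d e) = 0"
  using continuous_nonzero_imp_zero[OF continuous_line_point(2) assms] .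

section \<open>Exchanging letters between cameras\<close>

text \<open>The combination of two monomials that vanishes at \<open>P\<close>. If it lies in an ideal, the monomials agree
modulo the ideal up to the ratio of their values at \<open>P\<close>.\<close>

definition exchange :: "complex ^ 3 ^ 'm \<Rightarrow> ((3 \<times> 'm::finite) \<Rightarrow>\<^sub>0 nat) \<Rightarrow> ((3 \<times> 'm) \<Rightarrow>\<^sub>0 nat) \<Rightarrow> 'm lpoly" where
  "exchange P t t' = Const (monomial_value t' P) * mon t - Const (monomial_value t P) * mon t'"

lemma Const_cancel:
  fixes p :: "'m lpoly"
  assumes "ideal.subspace M" "c \<noteq> 0" "Const c * p \<in> M"
  shows "p \<in> M"
proof -
  have "Const (1 / c) * (Const c * p) \<in> M"
    using assms(1,3) by (rule ideal.subspace_scale)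
  moreover have "Const (1 / c) * (Const c * p) = p"
    using assms(2) by (simp flip: Const_mult mult.assoc)
  ultimately show ?thesis by simp
qed

lemma cross_multiplied_difference:
  fixes a b c :: "'a::comm_ring_1"
  shows "c * (b * x - a * y) = b * (c * x - a * z) + a * (b * z - c * y)"
  by (simp add: algebra_simps)

lemma exchange_trans:
  assumes "ideal.subspace M" "monomial_value s P \<noteq> 0"
    "exchange P t s \<in> M" "exchange P s t' \<in> M"
  shows "exchange P t t' \<in> M"
proof (rule Const_cancel[OF assms(1,2)])
  have "Const (monomial_value s P) * exchange P t t'
    = Const (monomial_value t' P) * exchange P t s + Const (monomial_value t P) * exchange P s t'"
    unfolding exchange_def by (rule cross_multiplied_difference)
  then show "Const (monomial_value s P) * exchange P t t' \<in> M"
    using assms by (simp add: ideal.subspace_add ideal.subspace_scale)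
qed

lemma mon_add: "mon (s + t) = mon s * mon t"
  by (simp add: mult_single)

lemma mon_unit [simp]: "mon (unit_exp i j) = Var i j"
  by (simp add: Var_def)

lemma monomial_value_unit: "monomial_value (unit_exp i j) P = P $ j $ i"
  by simp

lemma factored_difference:
  fixes c :: "'a::comm_ring_1"
  shows "c * p * (s * x) - c * q * (s * y) = c * (s * (p * x - q * y))"
  by (simp add: algebra_simps)

text \<open>An exchange of two letters reduces to a binomial quadric, multiplied by the common monomial.\<close>

lemma exchange_swap:
  "exchange P (s + (unit_exp v j + unit_exp w k)) (s + (unit_exp w j + unit_exp v k))
   = Const (monomial_value s P) * (mon s *
      (Const (P $ j $ w * P $ k $ v) * (Var v j * Var w k) -
       Const (P $ j $ v * P $ k $ w) * (Var w j * Var v k)))"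
  unfolding exchange_def mon_add mon_unit monomial_value_add monomial_value_unit
    Const_mult[of "monomial_value s P"]
  by (rule factored_difference)

lemma obtain_greater_if_sum_le:
  fixes f g :: "'i \<Rightarrow> nat"
  assumes "finite A" "sum g A \<le> sum f A" "k \<in> A" "f k < g k"
  obtains j where "j \<in> A" "g j < f j"
proof -
  have "\<exists>j\<in>A. g j < f j"
  proof (rule ccontr)
    assume "\<not> ?thesis"
    then have "sum f A < sum g A"
      using assms(1,3,4) by (intro sum_strict_mono_ex1) (auto simp: not_less)
    then show False using assms(2) by simp
  qed
  then show ?thesis using that by blast
qed

lemma exponent_split:
  fixes t :: "'x \<Rightarrow>\<^sub>0 nat"
  assumes "Poly_Mapping.lookup t p \<noteq> 0"
  obtains s where "t = s + Poly_Mapping.single p 1"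
proof -
  have "t = (t - Poly_Mapping.single p 1) + Poly_Mapping.single p 1"
    using assms by (intro poly_mapping_eqI) (auto simp: lookup_add lookup_minus lookup_single when_def)
  then show ?thesis using that by blast
qed

lemma exponent_split2:
  fixes t :: "'x \<Rightarrow>\<^sub>0 nat"
  assumes "Poly_Mapping.lookup t p \<noteq> 0" "Poly_Mapping.lookup t q \<noteq> 0" "p \<noteq> q"
  obtains s where "t = s + (Poly_Mapping.single p 1 + Poly_Mapping.single q 1)"
proof -
  obtain s where s: "t = s + Poly_Mapping.single p 1" using exponent_split[OF assms(1)] .
  have "Poly_Mapping.lookup s q \<noteq> 0"
    using assms s by (auto simp: lookup_add lookup_single when_def)
  then obtain s' where s': "s = s' + Poly_Mapping.single q 1" by (rule exponent_split)
  have "t = s' + (Poly_Mapping.single p 1 + Poly_Mapping.single q 1)"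
    unfolding s s' by (metis add.assoc add.commute)
  then show ?thesis by (rule that)
qed

text \<open>If the single exchanges lie in \<open>M\<close>, then so do all exchanges between monomials of equal degree that are
nonzero at \<open>P\<close>. The intermediate monomials must be nonzero at \<open>P\<close> as well, since otherwise
transitivity fails. Therefore the letters \<open>z\<close> are moved first, always to a camera where the target has
a \<open>z\<close>, and then the letters \<open>y\<close>. Besides letters of the target and \<open>x\<close>, this only introduces a \<open>y\<close> in
place of a \<open>z\<close>, and such a \<open>y\<close> is nonzero at \<open>P\<close> by the hypothesis \<open>yz\<close>. The predicate \<open>good\<close> records which cameras occur.\<close>

lemma exchange_in_ideal:
  fixes M :: "'m::finite lpoly set"
  assumes M: "ideal.subspace M"
    and good: "\<And>t t'. good t \<Longrightarrow> same_degree t t' \<Longrightarrow> good t'"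
    and x: "\<And>j. P $ j $ 1 \<noteq> 0"
    and yz: "\<And>t j. good t \<Longrightarrow> colsum t j \<noteq> 0 \<Longrightarrow> P $ j $ 3 \<noteq> 0 \<Longrightarrow> P $ j $ 2 \<noteq> 0"
    and swap: "\<And>s j k v w. good (s + (unit_exp v j + unit_exp w k)) \<Longrightarrow> monomial_value s P \<noteq> 0 \<Longrightarrow>
      j \<noteq> k \<Longrightarrow> v = 3 \<and> w = 1 \<or> v = 3 \<and> w = 2 \<or> v = 2 \<and> w = 1 \<Longrightarrow>
      P $ j $ v \<noteq> 0 \<Longrightarrow> P $ k $ w \<noteq> 0 \<Longrightarrow> P $ j $ w \<noteq> 0 \<Longrightarrow> P $ k $ v \<noteq> 0 \<Longrightarrow>
      mon s * (Const (P $ j $ w * P $ k $ v) * (Var v j * Var w k) -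
               Const (P $ j $ v * P $ k $ w) * (Var w j * Var v k)) \<in> M"
    and "good t" "same_degree t t'" "monomial_value t P \<noteq> 0" "monomial_value t' P \<noteq> 0"
  shows "exchange P t t' \<in> M"
  using assms(6-9)
proof (induction "\<Sum>p\<in>UNIV. Poly_Mapping.lookup t p - Poly_Mapping.lookup t' p"
    arbitrary: t rule: less_induct)
  case less
  note t = less.prems
  have col: "colsum t j = colsum t' j" and row: "rowsum t i = rowsum t' i" for i j
    using t(2) by (simp_all add: same_degree_def)
  have step: "exchange P t t' \<in> M"
    if vw: "v = 3 \<and> w = 1 \<or> v = 3 \<and> w = 2 \<or> v = 2 \<and> w = 1"
      and vj: "Poly_Mapping.lookup t' (v, j) < Poly_Mapping.lookup t (v, j)"
      and wk: "Poly_Mapping.lookup t' (w, k) < Poly_Mapping.lookup t (w, k)"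
      and vk: "Poly_Mapping.lookup t (v, k) < Poly_Mapping.lookup t' (v, k)"
    for v w :: 3 and j k
  proof -
    have jk: "j \<noteq> k" and vw': "v \<noteq> w" using vj vk vw by auto
    obtain s where s: "t = s + (unit_exp v j + unit_exp w k)"
      using exponent_split2[of t "(v, j)" "(w, k)"] vj wk jk by auto
    define t2 where "t2 = s + (unit_exp w j + unit_exp v k)"
    have same_degree: "same_degree t t2"
      unfolding s t2_def by (intro same_degree_add same_degree_refl same_degree_unit_swap)
    have sP: "monomial_value s P \<noteq> 0" and "P $ j $ v \<noteq> 0" "P $ k $ w \<noteq> 0"
      using t(3) by (auto simp: s monomial_value_add)
    moreover have "P $ k $ v \<noteq> 0"
      using t(4) vk by (metis monomial_value_eq_0_iff not_less_zero)
    moreover have "P $ j $ w \<noteq> 0"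
      using vw
    proof (elim disjE conjE)
      assume "v = 3" "w = 2"
      moreover have "colsum t j \<noteq> 0" by (simp add: s colsum_add colsum_single)
      ultimately show ?thesis using yz[OF t(1)] \<open>P $ j $ v \<noteq> 0\<close> by simp
    qed (use x in auto)
    ultimately have t2P: "monomial_value t2 P \<noteq> 0"
      and "exchange P t t2 \<in> M"
      using swap[of s v j w k] t(1) jk vw ideal.subspace_scale[OF M]
      by (simp_all add: t2_def monomial_value_add monomial_value_unit exchange_swap s del: One_nat_def)
    moreover have "exchange P t2 t' \<in> M"
    proof (rule less.hyps)
      \<comment> \<open>The measure is the truncated difference to the target: two excess letters leave, one letter
        enters where the target needs it, and only \<open>w\<^sub>j\<close> may become a new excess.\<close>
      let ?d = "\<lambda>t p. Poly_Mapping.lookup t p - Poly_Mapping.lookup t' p"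
      let ?i = "\<lambda>q p. if p = q then 1 else (0::nat)"
      have "?d t2 p + (?i (v, j) p + ?i (w, k) p) \<le> ?d t p + ?i (w, j) p" for p
        using vj wk vk jk vw' by (auto simp: s t2_def lookup_add lookup_single when_def)
      then have "(\<Sum>p\<in>UNIV. ?d t2 p + (?i (v, j) p + ?i (w, k) p)) \<le> (\<Sum>p\<in>UNIV. ?d t p + ?i (w, j) p)"
        by (intro sum_mono)
      then show "(\<Sum>p\<in>UNIV. ?d t2 p) < (\<Sum>p\<in>UNIV. ?d t p)"
        by (simp add: sum.distrib)
      show "good t2" using good t(1) same_degree .
      show "same_degree t2 t'" using same_degree t(2) by (metis same_degree_sym same_degree_trans)
    qed (use t2P t(4) in auto)
    ultimately show ?thesis using exchange_trans[OF M] by blast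
  qed
  show ?case
  proof (cases "\<exists>j. Poly_Mapping.lookup t (3, j) \<noteq> Poly_Mapping.lookup t' (3, j)")
    case True
    have "\<exists>k. Poly_Mapping.lookup t (3, k) < Poly_Mapping.lookup t' (3, k)"
      using True row[of 3]
        obtain_greater_if_sum_le[of UNIV "\<lambda>j. Poly_Mapping.lookup t (3, j)" "\<lambda>j. Poly_Mapping.lookup t' (3, j)"]
        obtain_greater_if_sum_le[of UNIV "\<lambda>j. Poly_Mapping.lookup t' (3, j)" "\<lambda>j. Poly_Mapping.lookup t (3, j)"]
      unfolding rowsum_def by (metis UNIV_I finite linorder_neqE_nat order_refl)
    then obtain k where k: "Poly_Mapping.lookup t (3, k) < Poly_Mapping.lookup t' (3, k)" ..
    obtain j where j: "Poly_Mapping.lookup t' (3, j) < Poly_Mapping.lookup t (3, j)"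
      using obtain_greater_if_sum_le[of UNIV "\<lambda>j. Poly_Mapping.lookup t' (3, j)" "\<lambda>j. Poly_Mapping.lookup t (3, j)" k]
        row[of 3] k unfolding rowsum_def by auto
    obtain w where w: "Poly_Mapping.lookup t' (w, k) < Poly_Mapping.lookup t (w, k)"
      using obtain_greater_if_sum_le[of UNIV "\<lambda>i. Poly_Mapping.lookup t' (i, k)" "\<lambda>i. Poly_Mapping.lookup t (i, k)" 3]
        col[of k] k unfolding colsum_def by auto
    have "w = 1 \<or> w = 2" using exhaust_3[of w] w k by auto
    then show ?thesis using step[of 3 w j k] j k w by auto
  next
    case z: False
    show ?thesis
    proof (cases "\<exists>j. Poly_Mapping.lookup t (2, j) \<noteq> Poly_Mapping.lookup t' (2, j)")
      case True
      have "\<exists>k. Poly_Mapping.lookup t (2, k) < Poly_Mapping.lookup t' (2, k)"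
        using True row[of 2]
          obtain_greater_if_sum_le[of UNIV "\<lambda>j. Poly_Mapping.lookup t (2, j)" "\<lambda>j. Poly_Mapping.lookup t' (2, j)"]
          obtain_greater_if_sum_le[of UNIV "\<lambda>j. Poly_Mapping.lookup t' (2, j)" "\<lambda>j. Poly_Mapping.lookup t (2, j)"]
        unfolding rowsum_def by (metis UNIV_I finite linorder_neqE_nat order_refl)
      then obtain k where k: "Poly_Mapping.lookup t (2, k) < Poly_Mapping.lookup t' (2, k)" ..
      obtain j where j: "Poly_Mapping.lookup t' (2, j) < Poly_Mapping.lookup t (2, j)"
        using obtain_greater_if_sum_le[of UNIV "\<lambda>j. Poly_Mapping.lookup t' (2, j)" "\<lambda>j. Poly_Mapping.lookup t (2, j)" k]
          row[of 2] k unfolding rowsum_def by auto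
      obtain w where w: "Poly_Mapping.lookup t' (w, k) < Poly_Mapping.lookup t (w, k)"
        using obtain_greater_if_sum_le[of UNIV "\<lambda>i. Poly_Mapping.lookup t' (i, k)" "\<lambda>i. Poly_Mapping.lookup t (i, k)" 2]
          col[of k] k unfolding colsum_def by auto
      have "w = 1" using exhaust_3[of w] w k z by auto
      then show ?thesis using step[of 2 w j k] j k w by auto
    next
      case y: False
      have "Poly_Mapping.lookup t (i, j) = Poly_Mapping.lookup t' (i, j)" for i j
        using exhaust_3[of i] y z col[of j] by (auto simp: colsum_def sum_3)
      then have "t = t'" by (intro poly_mapping_eqI) auto
      then show ?thesis using M by (simp add: exchange_def ideal.subspace_0)
    qed
  qed
qed

text \<open>Modulo \<open>M\<close>, a component is spanned by one monomial, and the coefficient of \<open>r\<close> is its value at \<open>P\<close> up to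
a nonzero factor.\<close>

lemma vanishing_at_point_imp_in_ideal:
  fixes M :: "'m::finite lpoly set"
  assumes M: "ideal.subspace M"
    and good: "\<And>t. same_degree t t0 \<Longrightarrow> good t"
    and ex: "\<And>t t'. good t \<Longrightarrow> same_degree t t' \<Longrightarrow> monomial_value t P \<noteq> 0 \<Longrightarrow>
      monomial_value t' P \<noteq> 0 \<Longrightarrow> exchange P t t' \<in> M"
    and zero: "\<And>t. good t \<Longrightarrow> monomial_value t P = 0 \<Longrightarrow> mon t \<in> M"
    and r: "r \<in> component_space t0" "eval_lpoly r P = 0"
  shows "r \<in> M"
proof -
  let ?K = "Poly_Mapping.keys r" and ?r = "Poly_Mapping.lookup r"
  have eq: "(\<Sum>t\<in>?K. Const (?r t) * mon t) = (\<Sum>t\<in>?K. Poly_Mapping.single t (?r t))"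
    by (simp add: Const_def mult_single)
  have rsum: "r = (\<Sum>t\<in>?K. Const (?r t) * mon t)"
    unfolding eq by (rule lpoly_eq_sum_single)
  have K: "same_degree t t0" "good t" if "t \<in> ?K" for t
    using that r(1) good by (auto simp: component_space_def)
  show ?thesis
  proof (cases "\<exists>t\<in>?K. monomial_value t P \<noteq> 0")
    case False
    then show ?thesis
      by (subst rsum) (auto intro!: ideal.subspace_sum[OF M] ideal.subspace_scale[OF M] zero K)
  next
    case True
    then obtain t1 where t1: "t1 \<in> ?K" "monomial_value t1 P \<noteq> 0" by blast
    have ex': "exchange P t t1 \<in> M" if "t \<in> ?K" for t
    proof (cases "monomial_value t P = 0")
      case True
      then show ?thesis
        using zero[OF K(2)[OF that]] by (simp add: exchange_def ideal.subspace_scale[OF M])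
    next
      case False
      then show ?thesis
        using ex[of t t1] K that t1 by (metis same_degree_sym same_degree_trans)
    qed
    have "(Const (\<Sum>t\<in>F. c t) :: 'm lpoly) = (\<Sum>t\<in>F. Const (c t))"
      for F :: "((3 \<times> 'm) \<Rightarrow>\<^sub>0 nat) set" and c
      by (induction F rule: infinite_finite_induct) (simp_all add: Const_add)
    then have "(Const (eval_lpoly r P) :: 'm lpoly) = (\<Sum>t\<in>?K. Const (?r t) * Const (monomial_value t P))"
      by (simp add: eval_lpoly_superset[of ?K] Const_mult)
    then have "(\<Sum>t\<in>?K. Const (?r t) * (Const (monomial_value t P) * mon t1)) = Const (eval_lpoly r P) * mon t1"
      by (simp only: sum_distrib_right mult.assoc)
    then have zero_sum: "(\<Sum>t\<in>?K. Const (?r t) * (Const (monomial_value t P) * mon t1)) = 0"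
      by (simp only: r(2) Const_0 mult_zero_left)
    have "(\<Sum>t\<in>?K. Const (?r t) * exchange P t t1)
      = (\<Sum>t\<in>?K. Const (monomial_value t1 P) * (Const (?r t) * mon t))
        - (\<Sum>t\<in>?K. Const (?r t) * (Const (monomial_value t P) * mon t1))"
      unfolding exchange_def right_diff_distrib sum_subtractf by (simp only: mult.left_commute)
    also have "\<dots> = Const (monomial_value t1 P) * r"
      by (simp only: zero_sum sum_distrib_left[symmetric] rsum[symmetric] diff_zero)
    finally have "Const (monomial_value t1 P) * r \<in> M"
      by (metis (no_types, lifting) ideal.subspace_sum[OF M] ideal.subspace_scale[OF M] ex')
    then show ?thesis using Const_cancel[OF M t1(2)] by blast
  qed
qed

lemma colsum_eq_0_iff: "colsum t j = 0 \<longleftrightarrow> (\<forall>i. Poly_Mapping.lookup t (i, j) = 0)"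
  by (simp add: colsum_def)

lemma Const_shift: "Const (- a + b) = Const b - Const a"
  by (simp add: Const_diff[symmetric])

lemma mon_split:
  assumes "Poly_Mapping.lookup t (i, j) \<noteq> 0"
  obtains s where "mon t = mon s * Var i j"
proof -
  obtain s where "t = s + Poly_Mapping.single (i, j) 1" using assms by (rule exponent_split)
  then show ?thesis using that by (metis mon_add mon_unit)
qed

lemma inj_nth_eq_iff:
  assumes "inj (\<lambda>j. u $ j)"
  shows "u $ j = u $ a \<longleftrightarrow> j = a"
  using assms by (auto simp: inj_def)

lemma span3:
  assumes "f \<in> S" "g \<in> S" "h \<in> S"
  shows "a * f + b * g + c * h \<in> ideal.span S"
  by (intro ideal.span_add ideal.span_scale ideal.span_base assms)

text \<open>In the following identities \<open>d\<^sub>j = u\<^sub>j - u\<^sub>a\<close> and \<open>e\<^sub>j = u\<^sub>j - u\<^sub>b\<close> are the values of \<open>y\<^sub>j\<close> and \<open>z\<^sub>j\<close> at the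
points with \<open>y\<^sub>a = 0\<close> and \<open>z\<^sub>b = 0\<close>; if \<open>z\<^sub>a = 0\<close> instead, both values are \<open>d\<^sub>j\<close>. The left-hand sides
are the binomials of the exchanges, and each is expressed by generators, by variables that vanish at
the point, and by binomials already treated. The summand \<open>0 * z a\<close> only
brings the first one into the shape of \<open>span3\<close>.\<close>

context
  fixes U x y z :: "'m \<Rightarrow> 'a::comm_ring_1"
begin

lemma affine_exchange_identity:
  "x a * ((U k - U a) * (z j * x k) - (U j - U a) * (x j * z k))
   = (- 1) * det3 x (\<lambda>j. U j * x j) z a j k + (U k - U j) * x j * x k * z a + 0 * z a"
  by (simp add: det3_def algebra_simps)

lemma collinear_exchange_identity:
  "x a * (d * (z j * y k) - d * (y j * z k))
   = (- d) * det3 x y z a j k + (d * (z j * x k - x j * z k)) * y a + (d * (x j * y k - x k * y j)) * z a"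
  by (simp add: det3_def algebra_simps)

text \<open>The combination of the two determinants eliminates \<open>x\<^sub>a\<close>. Thus \<open>x\<^sub>j : y\<^sub>j / d\<^sub>j\<close> is the same for all cameras
in the presence of \<open>z\<^sub>a\<close>, and one may trade \<open>x\<close> for \<open>y\<close>.\<close>

lemma ratio_exchange_identity:
  "z a * ((U k - U a) * (y j * x k) - (U j - U a) * (x j * y k))
   = (- 1) * det3 (\<lambda>j. U j * x j) y z a j k + U a * det3 x y z a j k
     + ((U k - U a) * x k * z j - (U j - U a) * x j * z k) * y a"
  by (simp add: det3_def algebra_simps)

text \<open>The exchange of \<open>z\<close> and \<open>x\<close> when the camera \<open>b\<close> carries the letter \<open>y\<close>. The last summand consists of two
ratio exchanges, which turn \<open>x\<^sub>b y\<^sub>j\<close> and \<open>x\<^sub>b y\<^sub>k\<close> in the determinant into multiples of \<open>y\<^sub>b x\<^sub>j\<close> and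
\<open>y\<^sub>b x\<^sub>k\<close>.\<close>

lemma mixed_exchange_identity:
  "z a * (y b * ((U k - U b) * (z j * x k) - (U j - U b) * (x j * z k)))
   = ((U a - U b) * z a) * det3 x y z b j k
     + ((U b - U a) * (x j * y k - x k * y j)) * (z a * z b)
     + (z j * (z a * ((U k - U a) * (y b * x k) - (U b - U a) * (x b * y k)))
       - z k * (z a * ((U j - U a) * (y b * x j) - (U b - U a) * (x b * y j))))"
  by (simp add: det3_def algebra_simps)

text \<open>The exchange of \<open>z\<close> and \<open>y\<close> when the camera \<open>b\<close> carries the letter \<open>x\<close>. Trading this \<open>x\<close> for a \<open>y\<close> by
ratio exchanges leads back to the previous case; the trade costs the factor \<open>u\<^sub>b - u\<^sub>a\<close>.\<close>

lemma mixed_exchange_identity':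
  "(U b - U a) * (z a * (x b * ((U j - U a) * (U k - U b) * (z j * y k) - (U j - U b) * (U k - U a) * (y j * z k))))
   = (U j - U a) * (U k - U a) * (z a * (y b * ((U k - U b) * (z j * x k) - (U j - U b) * (x j * z k))))
     - (U j - U a) * (U k - U b) * z j * (z a * ((U k - U a) * (y b * x k) - (U b - U a) * (x b * y k)))
     + (U j - U b) * (U k - U a) * z k * (z a * ((U j - U a) * (y b * x j) - (U b - U a) * (x b * y j)))"
  by (simp add: algebra_simps)

text \<open>Only letters \<open>y\<close> and \<open>z\<close> occur in these monomials, whereas every term of a \<open>3 \<times> 3\<close> determinant contains an
\<open>x\<close>; this exchange is what the quartics are needed for.\<close>

lemma quartic_exchange_identity:
  "z a * (y b * ((U j - U a) * (U k - U b) * (z j * y k) - (U j - U b) * (U k - U a) * (y j * z k)))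
   = (- 1) * Q4 U y z a b j k
     + ((U b - U a) * (U k - U j) * (y b * z j * z k) - (U j - U a) * (U k - U b) * (y j * z b * z k)
        + (U k - U a) * (U j - U b) * (y k * z b * z j)) * y a
     + ((U b - U a) * (U k - U j) * (y j * y k)) * (z a * z b)"
  by (simp add: Q4_def algebra_simps)

end

section \<open>Descent along the family of points\<close>

lemma colsum_neq_0_vertex:
  assumes "colsum s a \<noteq> 0" "monomial_value s P \<noteq> 0"
  obtains i s' where "mon s = mon s' * Var i a" "P $ a $ i \<noteq> 0"
proof -
  obtain i where i: "Poly_Mapping.lookup s (i, a) \<noteq> 0"
    using assms(1) by (auto simp: colsum_eq_0_iff)
  then have "P $ a $ i \<noteq> 0" using assms(2) monomial_value_eq_0_iff by blast
  then show ?thesis using that mon_split[OF i] by metis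
qed

lemma colsum_same_degree: "same_degree s t \<Longrightarrow> colsum s j = colsum t j"
  by (simp add: same_degree_def)

text \<open>At this point \<open>y\<^sub>a\<close> and \<open>z\<^sub>a\<close> are the only variables that vanish, so a monomial that is nonzero there
contains \<open>x\<^sub>a\<close>, and \<open>x\<^sub>a\<close> supports all exchanges among the other cameras.\<close>

lemma one_point_descent:
  fixes u :: "complex ^ 'm::finite"
  assumes u: "inj (\<lambda>j. u $ j)" and a: "colsum t0 a \<noteq> 0"
    and r: "r \<in> component_space t0" "eval_lpoly r (line_point u (- u $ a) 1 (- u $ a) 1) = 0"
  shows "r \<in> ideal.span (insert (Var 3 a) (insert (Var 2 a) (generators u)))"
    (is "_ \<in> ideal.span ?S")
proof -
  let ?P = "line_point u (- u $ a) 1 (- u $ a) 1"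
  have M: "ideal.subspace (ideal.span ?S)" by (rule ideal.subspace_span)
  note zero_iff = inj_nth_eq_iff[OF u]
  show ?thesis
  proof (rule vanishing_at_point_imp_in_ideal[OF M, where good = "\<lambda>t. colsum t a \<noteq> 0", OF _ _ _ r])
    fix t :: "(3 \<times> 'm) \<Rightarrow>\<^sub>0 nat"
    assume "monomial_value t ?P = 0"
    then obtain i j where t: "Poly_Mapping.lookup t (i, j) \<noteq> 0" and "?P $ j $ i = 0"
      unfolding monomial_value_eq_0_iff by blast
    then have "(i = 2 \<or> i = 3) \<and> j = a"
      using exhaust_3[of i] by (auto simp: zero_iff)
    then have "Var i j \<in> ?S" by auto
    moreover obtain s where "mon t = mon s * Var i j" using t by (rule mon_split)
    ultimately show "mon t \<in> ideal.span ?S"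
      by (simp only: ideal.span_scale ideal.span_base)
  next
    fix t t' :: "(3 \<times> 'm) \<Rightarrow>\<^sub>0 nat"
    assume "colsum t a \<noteq> 0" "same_degree t t'" "monomial_value t ?P \<noteq> 0" "monomial_value t' ?P \<noteq> 0"
    then show "exchange ?P t t' \<in> ideal.span ?S"
    proof (intro exchange_in_ideal[OF M, where good = "\<lambda>t. colsum t a \<noteq> 0"])
      fix s :: "(3 \<times> 'm) \<Rightarrow>\<^sub>0 nat" and j k :: 'm and v w :: 3
      assume good: "colsum (s + (unit_exp v j + unit_exp w k)) a \<noteq> 0"
        and s: "monomial_value s ?P \<noteq> 0"
        and vw: "v = 3 \<and> w = 1 \<or> v = 3 \<and> w = 2 \<or> v = 2 \<and> w = 1"
        and nz: "?P $ j $ v \<noteq> 0" "?P $ k $ v \<noteq> 0"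
      have jk: "j \<noteq> a" "k \<noteq> a" using nz vw by (auto simp: zero_iff)
      then have "colsum s a \<noteq> 0" using good by (simp add: colsum_add colsum_single)
      then obtain i s' where s': "mon s = mon s' * Var i a" and i: "?P $ a $ i \<noteq> 0"
        using s by (rule colsum_neq_0_vertex)
      have i: "i = 1" using exhaust_3[of i] i by auto
      let ?T = "Const (?P $ j $ w * ?P $ k $ v) * (Var v j * Var w k) -
        Const (?P $ j $ v * ?P $ k $ w) * (Var w j * Var v k)"
      have "Var 1 a * ?T \<in> ideal.span ?S"
        using vw
      proof (elim disjE conjE)
        assume vw: "v = 3" "w = 1"
        show ?thesis
          unfolding vw line_point_nth mult_1_left mult_1_right Const_shift
            affine_exchange_identity[of "Var 1" a "\<lambda>j. Const (u $ j)" k "Var 3" j]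
          by (intro span3) (auto simp: generatorsI)
      next
        assume vw: "v = 2" "w = 1"
        show ?thesis
          unfolding vw line_point_nth mult_1_left mult_1_right Const_shift
            affine_exchange_identity[of "Var 1" a "\<lambda>j. Const (u $ j)" k "Var 2" j]
          by (intro span3) (auto simp: generatorsI)
      next
        assume vw: "v = 3" "w = 2"
        show ?thesis
          unfolding vw line_point_nth
            collinear_exchange_identity[of "Var 1" a _ "Var 3" j "Var 2" k]
          by (intro span3) (auto simp: generatorsI)
      qed
      then show "mon s * ?T \<in> ideal.span ?S"
        unfolding s' i mult.assoc by (rule ideal.span_scale)
    qed (auto simp: colsum_same_degree zero_iff)
  qed (use a in \<open>auto simp: colsum_same_degree\<close>)
qed

text \<open>Here the role of \<open>M\<close> is played by the colon ideal of all \<open>q\<close> for which \<open>z\<^sub>a q\<close> lies in the ideal on the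
right. A monomial in which the camera \<open>a\<close> does not occur and which is nonzero at the point contains \<open>x\<^sub>b\<close>
or \<open>y\<^sub>b\<close>; either of them, together with \<open>z\<^sub>a\<close>, supports the exchanges.\<close>

lemma one_point_descent_below_z:
  fixes u :: "complex ^ 'm::finite"
  assumes u: "inj (\<lambda>j. u $ j)" and a: "colsum t0 a = 0" and b: "colsum t0 b \<noteq> 0"
    and r: "r \<in> component_space t0" "eval_lpoly r (line_point u (- u $ a) 1 (- u $ b) 1) = 0"
  shows "Var 3 a * r \<in> ideal.span (insert (Var 3 a * Var 3 b) (insert (Var 2 a) (generators u)))"
    (is "_ \<in> ideal.span ?S")
proof -
  let ?P = "line_point u (- u $ a) 1 (- u $ b) 1"
  define N where "N = ideal.span ?S"
  define M where "M = {q. Var 3 a * q \<in> N}"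
  have N: "ideal.subspace N" unfolding N_def by (rule ideal.subspace_span)
  have M: "ideal.subspace M"
  proof (rule ideal.subspaceI)
    show "c * q \<in> M" if "q \<in> M" for c q
      using that ideal.subspace_scale[OF N, of "Var 3 a * q" c] by (simp add: M_def mult.left_commute)
  qed (simp_all add: M_def ideal.subspace_0[OF N] ideal.subspace_add[OF N] distrib_left)
  note zero_iff = inj_nth_eq_iff[OF u]
  have ab: "a \<noteq> b" using a b by auto
  let ?U = "\<lambda>j. Const (u $ j)"
  let ?R = "\<lambda>j k. Var 3 a * ((?U k - ?U a) * (Var 2 j * Var 1 k) - (?U j - ?U a) * (Var 1 j * Var 2 k))"
  have R: "?R j k \<in> N" for j k
    unfolding N_def ratio_exchange_identity[where x = "Var 1" and y = "Var 2" and z = "Var 3" and U = ?U] by (intro span3) (auto simp: generatorsI)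
  let ?T = "\<lambda>j k. Var 3 a * (Var 2 b * ((?U k - ?U b) * (Var 3 j * Var 1 k) - (?U j - ?U b) * (Var 1 j * Var 3 k)))"
  have gen: "g \<in> N" if "g \<in> ?S" for g using that unfolding N_def by (rule ideal.span_base)
  have T: "?T j k \<in> N" for j k
    unfolding mixed_exchange_identity[where x = "Var 1" and y = "Var 2" and z = "Var 3" and U = ?U]
    by (rule ideal.subspace_add[OF N] ideal.subspace_diff[OF N]; (rule ideal.subspace_add[OF N] ideal.subspace_diff[OF N])?;
      rule ideal.subspace_scale[OF N]; rule R gen; simp add: generatorsI)
  have "r \<in> M"
  proof (rule vanishing_at_point_imp_in_ideal[OF M, where good = "\<lambda>t. colsum t a = 0 \<and> colsum t b \<noteq> 0", OF _ _ _ r])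
    fix t :: "(3 \<times> 'm) \<Rightarrow>\<^sub>0 nat"
    assume t: "colsum t a = 0 \<and> colsum t b \<noteq> 0" and "monomial_value t ?P = 0"
    then obtain i j where ij: "Poly_Mapping.lookup t (i, j) \<noteq> 0" and "?P $ j $ i = 0"
      unfolding monomial_value_eq_0_iff by blast
    moreover have "j \<noteq> a" using t ij by (auto simp: colsum_eq_0_iff)
    ultimately have ij': "i = 3" "j = b"
      using exhaust_3[of i] by (auto simp: zero_iff)
    obtain s where s: "mon t = mon s * Var i j" using ij by (rule mon_split)
    have "Var 3 a * mon t = mon s * (Var 3 a * Var 3 b)"
      unfolding s ij' by (rule mult.left_commute)
    also have "\<dots> \<in> N" unfolding N_def by (intro ideal.span_scale ideal.span_base) simp
    finally show "mon t \<in> M" by (simp add: M_def)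
  next
    fix t t' :: "(3 \<times> 'm) \<Rightarrow>\<^sub>0 nat"
    assume "colsum t a = 0 \<and> colsum t b \<noteq> 0" "same_degree t t'" "monomial_value t ?P \<noteq> 0" "monomial_value t' ?P \<noteq> 0"
    then show "exchange ?P t t' \<in> M"
    proof (intro exchange_in_ideal[OF M, where good = "\<lambda>t. colsum t a = 0 \<and> colsum t b \<noteq> 0"])
      fix s :: "(3 \<times> 'm) \<Rightarrow>\<^sub>0 nat" and j k :: 'm and v w :: 3
      assume good: "colsum (s + (unit_exp v j + unit_exp w k)) a = 0 \<and> colsum (s + (unit_exp v j + unit_exp w k)) b \<noteq> 0"
        and s: "monomial_value s ?P \<noteq> 0"
        and vw: "v = 3 \<and> w = 1 \<or> v = 3 \<and> w = 2 \<or> v = 2 \<and> w = 1"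
        and nz: "?P $ j $ v \<noteq> 0" "?P $ k $ v \<noteq> 0"
      let ?E = "Const (?P $ j $ w * ?P $ k $ v) * (Var v j * Var w k) -
        Const (?P $ j $ v * ?P $ k $ w) * (Var w j * Var v k)"
      have "Var 3 a * (mon s * ?E) \<in> N"
      proof (cases "v = 2")
        case True
        then have w: "w = 1" using vw by auto
        have "Var 3 a * ?E \<in> N"
          unfolding True w line_point_nth mult_1_left mult_1_right Const_shift by (rule R)
        then show ?thesis
          unfolding mult.left_commute[of "Var 3 a"] by (rule ideal.subspace_scale[OF N])
      next
        case False
        then have v: "v = 3" and w: "w = 1 \<or> w = 2" using vw by auto
        have jk: "j \<noteq> b" "k \<noteq> b" using nz by (auto simp: zero_iff v)
        then have "colsum s b \<noteq> 0" using good by (simp add: colsum_add colsum_single)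
        then obtain i s' where s': "mon s = mon s' * Var i b" and "?P $ b $ i \<noteq> 0"
          using s by (rule colsum_neq_0_vertex)
        then have i: "i = 1 \<or> i = 2" using exhaust_3[of i] by auto
        have "Var 3 a * (Var i b * ?E) \<in> N"
          using i w
        proof (elim disjE)
          assume iw: "i = 1" "w = 1"
          have "Var 1 b * ?E \<in> ideal.span (insert (Var 3 b) (generators u))"
            unfolding v iw line_point_nth mult_1_left mult_1_right Const_shift
              affine_exchange_identity[of "Var 1" b "\<lambda>j. Const (u $ j)" k "Var 3" j]
            by (intro span3) (auto simp: generatorsI)
          then obtain q where q: "Var 1 b * ?E - q * Var 3 b \<in> ideal.span (generators u)"
            unfolding ideal.span_breakdown_eq by blast
          have "ideal.span (generators u) \<subseteq> N"
            unfolding N_def by (rule ideal.span_mono) auto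
          then have "Var 3 a * (Var 1 b * ?E - q * Var 3 b) \<in> N"
            using q by (intro ideal.subspace_scale[OF N]) auto
          moreover have "q * (Var 3 a * Var 3 b) \<in> N"
            unfolding N_def by (intro ideal.span_scale ideal.span_base) simp
          ultimately have "Var 3 a * (Var 1 b * ?E - q * Var 3 b) + q * (Var 3 a * Var 3 b) \<in> N"
            by (rule ideal.subspace_add[OF N])
          moreover have "Var 3 a * (Var 1 b * ?E - q * Var 3 b) + q * (Var 3 a * Var 3 b) = Var 3 a * (Var 1 b * ?E)"
            by (simp only: right_diff_distrib mult.left_commute[of q] diff_add_cancel)
          ultimately show ?thesis by (simp only: iw)
        next
          assume iw: "i = 2" "w = 1"
          show ?thesis
            unfolding v iw line_point_nth mult_1_left mult_1_right Const_shift by (rule T)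
        next
          assume iw: "i = 1" "w = 2"
          have "(?U b - ?U a) * (Var 3 a * (Var i b * ?E)) \<in> N"
            unfolding v iw line_point_nth mult_1_left mult_1_right Const_shift Const_mult
              mixed_exchange_identity'[where x = "Var 1" and y = "Var 2" and z = "Var 3" and U = ?U]
            by (intro ideal.subspace_add[OF N] ideal.subspace_diff[OF N] ideal.subspace_scale[OF N] R T)
          then show ?thesis
            unfolding Const_diff[symmetric]
            using Const_cancel[OF N] u ab by (metis (no_types, lifting) eq_iff_diff_eq_0 injD)
        next
          assume iw: "i = 2" "w = 2"
          show ?thesis
            unfolding v iw line_point_nth mult_1_left mult_1_right Const_shift Const_mult
              quartic_exchange_identity[where y = "Var 2" and z = "Var 3" and U = ?U] N_def
            by (intro span3) (auto simp: generatorsI)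
        qed
        then have "mon s' * (Var 3 a * (Var i b * ?E)) \<in> N"
          by (rule ideal.subspace_scale[OF N])
        then show ?thesis
          unfolding s' mult.assoc mult.left_commute[of "Var 3 a" "mon s'"] .
      qed
      then show "mon s * ?E \<in> M" by (simp only: M_def mem_Collect_eq)
    next
      fix t :: "(3 \<times> 'm) \<Rightarrow>\<^sub>0 nat" and j
      assume "colsum t a = 0 \<and> colsum t b \<noteq> 0" "colsum t j \<noteq> 0"
      then have "j \<noteq> a" by auto
      then show "?P $ j $ 2 \<noteq> 0" by (simp add: zero_iff)
    qed (auto simp: colsum_same_degree)
  qed (use a b in \<open>auto simp: colsum_same_degree\<close>)
  then show ?thesis by (simp add: M_def N_def)
qed

lemma eval_constant_component:
  assumes "p \<in> component_space t0" "total_degree t0 = 0" "eval_lpoly p l = 0"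
  shows "p = 0"
proof -
  have "t = 0" if "t \<in> Poly_Mapping.keys p" for t
  proof (rule poly_mapping_eqI)
    fix ij
    have "total_degree t = 0"
      using that assms(1,2) same_degree_total_degree by (fastforce simp: component_space_def)
    then show "Poly_Mapping.lookup t ij = Poly_Mapping.lookup 0 ij"
      by (cases ij) (simp add: total_degree_def colsum_eq_0_iff)
  qed
  then have "Poly_Mapping.keys p \<subseteq> {0}" by blast
  then have "Poly_Mapping.lookup p 0 = 0"
    using assms(3) by (simp add: eval_lpoly_superset[of "{0}"])
  then show "p = 0"
    using \<open>Poly_Mapping.keys p \<subseteq> {0}\<close>
    by (metis in_keys_iff keys_eq_empty subset_singletonD singletonI)
qed

lemma insert_homogeneous:
  "homogeneous v \<Longrightarrow> \<forall>g\<in>G. homogeneous g \<Longrightarrow> \<forall>g\<in>insert v G. homogeneous g"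
  by blast

lemma homogeneous_mult: "homogeneous p \<Longrightarrow> homogeneous q \<Longrightarrow> homogeneous (p * q)"
  unfolding homogeneous_def using component_space_mult by blast

lemma eval_span_insert_y:
  assumes "p \<in> ideal.span (insert (Var 2 a) (generators u))"
  shows "eval_lpoly p (line_point u (- u $ a) 1 d e) = 0"
  using assms
  by (rule eval_span_eq_zero[rotated])
    (auto intro: eval_line_point_eq_zero ideal.span_base)

lemma exists_colsum_neq_0:
  assumes "total_degree t \<noteq> 0"
  obtains b where "colsum t b \<noteq> 0"
  using assms by (auto simp: total_degree_def)

text \<open>The parameters \<open>b = - u\<^sub>a\<close>, \<open>c = 1\<close> describe the points with \<open>y\<^sub>a = 0\<close>. Both \<open>z\<^sub>a\<close> and \<open>z\<^sub>b\<close> can be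
cancelled on this family, and the cofactor again does not involve the camera \<open>a\<close>.\<close>

lemma pencil_descent_below_z:
  fixes u :: "complex ^ 'm::finite"
  assumes u: "inj (\<lambda>j. u $ j)" and "colsum t0 a = 0"
    and "r \<in> component_space t0" "\<And>d e. eval_lpoly r (line_point u (- u $ a) 1 d e) = 0"
  shows "Var 3 a * r \<in> ideal.span (insert (Var 2 a) (generators u))"
  using assms(2-4)
proof (induction "total_degree t0" arbitrary: t0 r rule: less_induct)
  case less
  let ?S = "insert (Var 2 a) (generators u)"
  show ?case
  proof (cases "total_degree t0 = 0")
    case True
    then have "r = 0" using eval_constant_component less.prems by blast
    then show ?thesis by (simp add: ideal.span_zero)
  next
    case False
    then obtain b where b: "colsum t0 b \<noteq> 0" by (rule exists_colsum_neq_0)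
    have "Var 3 a * r \<in> component_space (unit_exp 3 a + t0)"
      by (intro component_space_mult Var_in_component_space less.prems)
    moreover have "Var 3 a * r \<in> ideal.span (insert (Var 3 a * Var 3 b) ?S)"
      by (rule one_point_descent_below_z[OF u less.prems(1) b less.prems(2,3)])
    ultimately obtain q where q: "Var 3 a * Var 3 b * q \<in> component_space (unit_exp 3 a + t0)"
      "Var 3 a * r - Var 3 a * Var 3 b * q \<in> ideal.span ?S"
      by (rule homogeneous_span_insert[OF insert_homogeneous[OF Var_homogeneous generators_homogeneous]
            homogeneous_mult[OF Var_homogeneous Var_homogeneous]])
    have "(d + u $ a * e) * eval_lpoly (Var 3 b * q) (line_point u (- u $ a) 1 d e) = 0" for d e
      using eval_span_insert_y[OF q(2), of d e] less.prems(3)[of d e] by simp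
    then have "eval_lpoly (Var 3 b * q) (line_point u (- u $ a) 1 d e) = 0" for d e
      by (rule cancel_z)
    then have "(d + u $ b * e) * eval_lpoly q (line_point u (- u $ a) 1 d e) = 0" for d e
      by simp
    then have q_vanishes: "eval_lpoly q (line_point u (- u $ a) 1 d e) = 0" for d e
      by (rule cancel_z)
    have "Var 3 a * q \<in> ideal.span ?S"
    proof (cases "q = 0")
      case False
      have "mon (unit_exp 3 a + unit_exp 3 b) * q \<in> component_space (unit_exp 3 a + t0)"
        using q(1) by (simp only: mon_add mon_unit)
      then obtain t1 where t1: "q \<in> component_space t1"
        "same_degree (unit_exp 3 a + unit_exp 3 b + t1) (unit_exp 3 a + t0)"
        using False by (rule component_space_quotient)
      then have same_degree: "same_degree (unit_exp 3 b + t1) t0"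
        by (metis add.assoc same_degree_cancel)
      show ?thesis
      proof (rule less.hyps)
        show "total_degree t1 < total_degree t0"
          using same_degree_total_degree[OF same_degree] by (simp add: total_degree_add)
        show "colsum t1 a = 0"
          using colsum_same_degree[OF same_degree, of a] less.prems(1) by (simp add: colsum_add)
      qed (use t1 q_vanishes in auto)
    qed (simp add: ideal.span_zero)
    then have "Var 3 b * (Var 3 a * q) \<in> ideal.span ?S" by (rule ideal.span_scale)
    then have "Var 3 a * Var 3 b * q \<in> ideal.span ?S"
      by (simp only: mult.assoc mult.left_commute)
    then show ?thesis using ideal.span_add[OF q(2)] by fastforce
  qed
qed

text \<open>Dividing by \<open>z\<^sub>a\<close> lowers the degree in the camera \<open>a\<close>; once it reaches zero, the cofactor is covered by
\<open>pencil_descent_below_z\<close>, which retains the factor \<open>z\<^sub>a\<close>.\<close>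

lemma pencil_descent:
  fixes u :: "complex ^ 'm::finite"
  assumes u: "inj (\<lambda>j. u $ j)" and "colsum t0 a \<noteq> 0"
    and "r \<in> component_space t0" "\<And>d e. eval_lpoly r (line_point u (- u $ a) 1 d e) = 0"
  shows "r \<in> ideal.span (insert (Var 2 a) (generators u))"
  using assms(2-4)
proof (induction "total_degree t0" arbitrary: t0 r rule: less_induct)
  case less
  let ?S = "insert (Var 2 a) (generators u)"
  have "r \<in> ideal.span (insert (Var 3 a) ?S)"
    by (rule one_point_descent[OF u less.prems])
  with less.prems(2) obtain q where q: "Var 3 a * q \<in> component_space t0" "r - Var 3 a * q \<in> ideal.span ?S"
    by (rule homogeneous_span_insert[OF insert_homogeneous[OF Var_homogeneous generators_homogeneous] Var_homogeneous])
  have "(d + u $ a * e) * eval_lpoly q (line_point u (- u $ a) 1 d e) = 0" for d e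
    using eval_span_insert_y[OF q(2), of d e] less.prems(3)[of d e] by simp
  then have q_vanishes: "eval_lpoly q (line_point u (- u $ a) 1 d e) = 0" for d e
    by (rule cancel_z)
  have "Var 3 a * q \<in> ideal.span ?S"
  proof (cases "q = 0")
    case False
    have "mon (unit_exp 3 a) * q \<in> component_space t0"
      using q(1) by (simp only: mon_unit)
    then obtain t1 where t1: "q \<in> component_space t1" and same_degree: "same_degree (unit_exp 3 a + t1) t0"
      using False by (rule component_space_quotient)
    show ?thesis
    proof (cases "colsum t1 a = 0")
      case True
      then show ?thesis using pencil_descent_below_z[OF u True t1 q_vanishes] by blast
    next
      case False
      have "total_degree t1 < total_degree t0"
        using same_degree_total_degree[OF same_degree] by (simp add: total_degree_add)
      then have "q \<in> ideal.span ?S" using False t1 q_vanishes by (rule less.hyps)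
      then show ?thesis by (rule ideal.span_scale)
    qed
  qed (simp add: ideal.span_zero)
  then show ?case using ideal.span_add[OF q(2)] by fastforce
qed

lemma component_in_generated_ideal:
  fixes u :: "complex ^ 'm::finite"
  assumes u: "inj (\<lambda>j. u $ j)"
    and "p \<in> component_space t0" "\<And>b c d e. eval_lpoly p (line_point u b c d e) = 0"
  shows "p \<in> ideal.span (generators u)"
  using assms(2,3)
proof (induction "total_degree t0" arbitrary: t0 p rule: less_induct)
  case less
  show ?case
  proof (cases "total_degree t0 = 0")
    case True
    then have "p = 0" using eval_constant_component less.prems by blast
    then show ?thesis by (simp add: ideal.span_zero)
  next
    case False
    then obtain a where a: "colsum t0 a \<noteq> 0" by (rule exists_colsum_neq_0)
    have "p \<in> ideal.span (insert (Var 2 a) (generators u))"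
      by (rule pencil_descent[OF u a less.prems])
    with less.prems(1) obtain q where q: "Var 2 a * q \<in> component_space t0" "p - Var 2 a * q \<in> ideal.span (generators u)"
      by (rule homogeneous_span_insert[OF generators_homogeneous Var_homogeneous])
    have "(b + u $ a * c) * eval_lpoly q (line_point u b c d e) = 0" for b c d e
      using eval_line_point_eq_zero[OF q(2), of b c d e] less.prems(2)[of b c d e] by simp
    then have q_vanishes: "eval_lpoly q (line_point u b c d e) = 0" for b c d e
      by (rule cancel_y)
    have "q \<in> ideal.span (generators u)"
    proof (cases "q = 0")
      case False
      have "mon (unit_exp 2 a) * q \<in> component_space t0"
        using q(1) by (simp only: mon_unit)
      then obtain t1 where t1: "q \<in> component_space t1" and same_degree: "same_degree (unit_exp 2 a + t1) t0"
        using False by (rule component_space_quotient)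
      have "total_degree t1 < total_degree t0"
        using same_degree_total_degree[OF same_degree] by (simp add: total_degree_add)
      then show ?thesis using t1 q_vanishes by (rule less.hyps)
    qed (simp add: ideal.span_zero)
    then have "Var 2 a * q \<in> ideal.span (generators u)" by (rule ideal.span_scale)
    then show ?thesis using ideal.span_add[OF q(2)] by fastforce
  qed
qed

section \<open>The line multiview variety\<close>

lemma camera_mult_nth:
  "(camera v *v x) $ 1 = x $ 1 + v * x $ 4" "(camera v *v x) $ 2 = x $ 2" "(camera v *v x) $ 3 = x $ 3"
  by (simp_all add: camera_def matrix_vector_mult_def sum_4 vector_4)

lemma cross_nth:
  "cross x y $ 1 = x $ 2 * y $ 3 - x $ 3 * y $ 2"
  "cross x y $ 2 = x $ 3 * y $ 1 - x $ 1 * y $ 3"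
  "cross x y $ 3 = x $ 1 * y $ 2 - x $ 2 * y $ 1"
  by (simp_all add: cross_def)

text \<open>The numbers \<open>A, B, B', C, C'\<close> are five of the Pluecker coordinates of the line through \<open>a\<close> and \<open>b\<close>.\<close>

lemma line_images_affine:
  assumes "l \<in> line_images (\<lambda>i. camera (u $ i))"
  obtains s A B B' C C' where "\<And>j. l $ j $ 1 = s j * A"
    "\<And>j. l $ j $ 2 = s j * (B + u $ j * B')" "\<And>j. l $ j $ 3 = s j * (C + u $ j * C')"
proof -
  obtain a b where "\<And>j. \<exists>c. l $ j = c *s cross (camera (u $ j) *v a) (camera (u $ j) *v b)"
    using assms unfolding line_images_def by blast
  then obtain s where s: "\<And>j. l $ j = s j *s cross (camera (u $ j) *v a) (camera (u $ j) *v b)"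
    by metis
  show ?thesis
  proof (rule that[of s "a $ 2 * b $ 3 - a $ 3 * b $ 2" "a $ 3 * b $ 1 - a $ 1 * b $ 3"
      "a $ 3 * b $ 4 - a $ 4 * b $ 3" "a $ 1 * b $ 2 - a $ 2 * b $ 1" "a $ 4 * b $ 2 - a $ 2 * b $ 4"])
  qed (simp_all add: s cross_nth camera_mult_nth algebra_simps)
qed

text \<open>The torus orbits of the parametrised points. The factors \<open>s\<^sub>j\<close> represent the same point of the product
of projective planes, and the factors \<open>y\<^sub>i\<close> change the parameters of the line.\<close>

definition scaled_points :: "complex ^ 'm::finite \<Rightarrow> (complex ^ 3 ^ 'm) set" where
  "scaled_points u = {(\<chi> j i. s j * y i * line_point u b c d e $ j $ i) | s y b c d e.
     (\<forall>j. s j \<noteq> 0) \<and> (\<forall>i. y i \<noteq> 0)}"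

lemma scaled_pointsI:
  "(\<And>j. s j \<noteq> 0) \<Longrightarrow> (\<And>i. y i \<noteq> 0) \<Longrightarrow>
    (\<chi> j i. s j * y i * line_point u b c d e $ j $ i) \<in> scaled_points u"
  unfolding scaled_points_def by blast

text \<open>The line is spanned by its points with \<open>(y, z) = (1, 0)\<close> and \<open>(y, z) = (0, 1)\<close>; it exists because
\<open>A \<noteq> 0\<close>. Both \<open>y\<close> and \<open>z\<close> vanish at the centers but not simultaneously on this line.\<close>

lemma scaled_points_subset_images:
  "scaled_points u \<subseteq> line_images (\<lambda>i. camera (u $ i))"
proof
  fix l assume "l \<in> scaled_points u"
  then obtain s y b c d e where l: "l = (\<chi> j i. s j * y i * line_point u b c d e $ j $ i)"
    and s: "\<And>j. s j \<noteq> 0" and y: "\<And>i. y i \<noteq> 0"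
    unfolding scaled_points_def by blast
  define p :: "complex ^ 4" where "p = vector [- (y 2 * b / y 1), 1, 0, - (y 2 * c / y 1)]"
  define q :: "complex ^ 4" where "q = vector [- (y 3 * d / y 1), 0, 1, - (y 3 * e / y 1)]"
  have p: "p $ 1 = - (y 2 * b / y 1)" "p $ 2 = 1" "p $ 3 = 0" "p $ 4 = - (y 2 * c / y 1)"
    and q: "q $ 1 = - (y 3 * d / y 1)" "q $ 2 = 0" "q $ 3 = 1" "q $ 4 = - (y 3 * e / y 1)"
    by (simp_all add: p_def q_def vector_4)
  have span: "\<exists>g h. x = g *s p + h *s q" if "x \<in> vec.span {p, q}" for x
    using that by (force simp: vec.span_insert vec.span_empty algebra_simps)
  have "vec.independent {p, q}"
  proof -
    have "p \<notin> vec.span {q}"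
      using p(2) q(2) by (auto simp: vec.span_singleton)
    moreover have "q \<noteq> 0" using q(3) by auto
    ultimately show ?thesis by (simp add: vec.independent_insert)
  qed
  moreover have "p \<noteq> q" using p(2) q(2) by auto
  ultimately have "vec.dim (vec.span {p, q}) = 2"
    by (simp add: vec.dim_eq_card_independent)
  moreover have "vec.span {p, q} \<inter> center (camera (u $ i)) = {0}" for i
  proof -
    have "x = 0" if x: "x \<in> vec.span {p, q}" "camera (u $ i) *v x = 0" for x
    proof -
      obtain g h where x': "x = g *s p + h *s q" using span[OF x(1)] by blast
      have "x $ 2 = 0" "x $ 3 = 0" using camera_mult_nth(2,3)[of "u $ i" x] x(2) by simp_all
      then show ?thesis by (simp add: x' p q)
    qed
    then show ?thesis by (auto simp: center_def vec.span_zero)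
  qed
  moreover have "\<exists>c. c \<noteq> 0 \<and> l $ i = c *s cross (camera (u $ i) *v p) (camera (u $ i) *v q)" for i
  proof (intro exI conjI)
    show "s i * y 1 \<noteq> 0" using s y by simp
    show "l $ i = (s i * y 1) *s cross (camera (u $ i) *v p) (camera (u $ i) *v q)"
      using y[of 1] by (simp add: vec_eq_iff forall_3 cross_nth camera_mult_nth p q l field_simps)
  qed
  ultimately show "l \<in> line_images (\<lambda>i. camera (u $ i))"
    unfolding line_images_def by blast
qed

lemma scaled_points_affine:
  assumes "l \<in> scaled_points u"
  obtains s A B B' C C' where "\<And>j. l $ j $ 1 = s j * A"
    "\<And>j. l $ j $ 2 = s j * (B + u $ j * B')" "\<And>j. l $ j $ 3 = s j * (C + u $ j * C')"
  by (rule line_images_affine[OF subsetD[OF scaled_points_subset_images assms]]) (rule that)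

lemma images_generated_vanish:
  assumes "l \<in> line_images (\<lambda>i. camera (u $ i))" "p \<in> ideal.span (generators u)"
  shows "eval_lpoly p l = 0"
proof -
  obtain s A B B' C C' where "\<And>j. l $ j $ 1 = s j * A"
    "\<And>j. l $ j $ 2 = s j * (B + u $ j * B')" "\<And>j. l $ j $ 3 = s j * (C + u $ j * C')"
    using assms(1) by (rule line_images_affine) blast
  then have "eval_lpoly g l = 0" if "g \<in> generators u" for g
    using generators_vanish[OF that] by blast
  then show ?thesis using assms(2) by (rule eval_span_eq_zero)
qed

text \<open>The components of \<open>p\<close> are split off one by one, which decreases the number of monomials.\<close>

lemma vanishing_on_scaled_points:
  fixes u :: "complex ^ 'm::finite"
  assumes u: "inj (\<lambda>j. u $ j)" and "\<And>l. l \<in> scaled_points u \<Longrightarrow> eval_lpoly p l = 0"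
  shows "p \<in> ideal.span (generators u)"
  using assms(2)
proof (induction "card (Poly_Mapping.keys p)" arbitrary: p rule: less_induct)
  case less
  show ?case
  proof (cases "p = 0")
    case False
    then obtain t where t: "t \<in> Poly_Mapping.keys p" by (metis keys_eq_empty all_not_in_conv)
    have "eval_lpoly (component t p) (line_point u b c d e) = 0" for b c d e
    proof (rule eval_component_eq_zero)
      fix x :: "'m \<Rightarrow> complex" and y :: "3 \<Rightarrow> complex"
      assume "\<And>j. x j \<noteq> 0" "\<And>i. y i \<noteq> 0"
      then show "eval_lpoly p (\<chi> j i. x j * y i * line_point u b c d e $ j $ i) = 0"
        by (intro less.prems scaled_pointsI)
    qed
    then have c: "component t p \<in> ideal.span (generators u)"
      by (rule component_in_generated_ideal[OF u component_in_space])
    have "p - component t p \<in> ideal.span (generators u)"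
    proof (rule less.hyps)
      have "Poly_Mapping.keys (p - component t p) \<subseteq> Poly_Mapping.keys p - {t}"
        by (auto simp: in_keys_iff lookup_minus lookup_component split: if_splits)
      then show "card (Poly_Mapping.keys (p - component t p)) < card (Poly_Mapping.keys p)"
        using t by (intro psubset_card_mono) auto
      fix l assume "l \<in> scaled_points u"
      then show "eval_lpoly (p - component t p) l = 0"
        using less.prems images_generated_vanish[OF _ c] scaled_points_subset_images by auto
    qed
    from ideal.span_add[OF this c] show ?thesis by simp
  qed (simp add: ideal.span_zero)
qed

lemma homogeneous_imp_multihomogeneous:
  assumes "homogeneous p" shows "multihomogeneous p"
proof -
  obtain t0 where "\<And>t. t \<in> Poly_Mapping.keys p \<Longrightarrow> colsum t = colsum t0"
    using assms by (auto simp: homogeneous_def component_space_def same_degree_def)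
  then show ?thesis
    unfolding multihomogeneous_def by (intro exI[of _ "colsum t0"]) (simp flip: colsum_def)
qed

text \<open>The generators are multihomogeneous and hence vanish on the Zariski closure as soon as they vanish on
the images of lines; the scaled points are nonzero in every factor and therefore belong to the
variety.\<close>

lemma vanishing_ideal_line_multiview_variety:
  fixes u :: "complex ^ 'm::finite"
  assumes u: "inj (\<lambda>j. u $ j)"
  shows "vanishing_ideal (line_multiview_variety (\<lambda>i. camera (u $ i))) = ideal.span (generators u)"
proof
  show "ideal.span (generators u) \<subseteq> vanishing_ideal (line_multiview_variety (\<lambda>i. camera (u $ i)))"
  proof
    fix p assume p: "p \<in> ideal.span (generators u)"
    have "eval_lpoly g l = 0" if l: "l \<in> line_multiview_variety (\<lambda>i. camera (u $ i))"
      and g: "g \<in> generators u" for g l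
    proof -
      have "multihomogeneous g"
        using g generators_homogeneous homogeneous_imp_multihomogeneous by blast
      moreover have "\<forall>x\<in>line_images (\<lambda>i. camera (u $ i)). eval_lpoly g x = 0"
        using images_generated_vanish ideal.span_base[OF g] by blast
      ultimately show ?thesis
        using l unfolding line_multiview_variety_def zariski_closure_def by blast
    qed
    then show "p \<in> vanishing_ideal (line_multiview_variety (\<lambda>i. camera (u $ i)))"
      using eval_span_eq_zero[OF _ p] by (simp add: vanishing_ideal_def)
  qed
  have "scaled_points u \<subseteq> line_multiview_variety (\<lambda>i. camera (u $ i))"
  proof
    fix l assume l: "l \<in> scaled_points u"
    then have "l $ j $ 1 \<noteq> 0" for j by (auto simp: scaled_points_def)
    then have "\<forall>j. l $ j \<noteq> 0" by (metis zero_index)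
    then show "l \<in> line_multiview_variety (\<lambda>i. camera (u $ i))"
      using l scaled_points_subset_images
      unfolding line_multiview_variety_def zariski_closure_def by blast
  qed
  then show "vanishing_ideal (line_multiview_variety (\<lambda>i. camera (u $ i))) \<subseteq> ideal.span (generators u)"
    using vanishing_on_scaled_points[OF u] by (auto simp: vanishing_ideal_def)
qed

section \<open>Comparison of the two sets of generators\<close>

lemma sum_span_singletons:
  assumes "finite A"
  shows "(\<Sum>s\<in>A. ideal.span {f s}) = ideal.span (f ` A)"
  using assms
proof (induction A rule: finite_induct)
  case (insert s A)
  have "ideal.span (f ` insert s A) = ideal.span ({f s} \<union> f ` A)" by simp
  then show ?case
    using insert unfolding ideal.span_Un by (auto simp: set_plus_def)
qed simp

lemma I_tilde_eq_span:
  "I_tilde u = ideal.span (minors3 (plane_matrix (\<lambda>i. camera (u $ i))) \<union> (\<lambda>s. det (Phi u s)) ` quadruples)"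
  unfolding I_tilde_def ideal.span_Un by (subst sum_span_singletons) (auto simp: set_plus_def)

text \<open>The rows of the matrix with columns \<open>C(u\<^sub>j)\<^sup>T l\<^sub>j\<close>.\<close>

definition plane_row :: "complex ^ 'm \<Rightarrow> 4 \<Rightarrow> 'm \<Rightarrow> 'm lpoly" where
  "plane_row u r = (if r = 1 then Var 1 else if r = 2 then Var 2 else if r = 3 then Var 3
     else (\<lambda>j. Const (u $ j) * Var 1 j))"

lemma plane_matrix_nth: "plane_matrix (\<lambda>i. camera (u $ i)) $ r $ j = plane_row u r j"
  using exhaust_4[of r]
  by (auto simp: plane_matrix_def plane_row_def map_matrix_def transpose_def
      matrix_vector_mult_def sum_3 lvec_def camera_def vector_4)

lemma det_submatrix_eq_det3:
  "det ((\<chi> p q. plane_matrix (\<lambda>i. camera (u $ i)) $ r p $ c q) :: 'm::finite lpoly ^ 3 ^ 3)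
    = det3 (plane_row u (r 1)) (plane_row u (r 2)) (plane_row u (r 3)) (c 1) (c 2) (c 3)"
  by (simp add: det_3 plane_matrix_nth det3_def algebra_simps)

lemma eval_plane_row:
  assumes "\<And>j. l $ j $ 1 = s j * A" "\<And>j. l $ j $ 2 = s j * (B + u $ j * B')"
    "\<And>j. l $ j $ 3 = s j * (C + u $ j * C')"
  shows "\<exists>D D'. (\<lambda>j. eval_lpoly (plane_row u r j) l) = (\<lambda>j. s j * (D + u $ j * D'))"
proof -
  have "(\<lambda>j. eval_lpoly (plane_row u 1 j) l) = (\<lambda>j. s j * (A + u $ j * 0))"
    "(\<lambda>j. eval_lpoly (plane_row u 2 j) l) = (\<lambda>j. s j * (B + u $ j * B'))"
    "(\<lambda>j. eval_lpoly (plane_row u 3 j) l) = (\<lambda>j. s j * (C + u $ j * C'))"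
    "(\<lambda>j. eval_lpoly (plane_row u 4 j) l) = (\<lambda>j. s j * (0 + u $ j * A))"
    by (simp_all add: plane_row_def assms mult.left_commute)
  then show ?thesis using exhaust_4[of r] by blast
qed

text \<open>The minors vanish at the scaled points, so the characterisation of the vanishing polynomials applies
to them. The quartics are generators up to sign.\<close>

lemma I_tilde_subset:
  fixes u :: "complex ^ 'm::{finite,linorder}"
  assumes u: "inj (\<lambda>j. u $ j)"
  shows "I_tilde u \<subseteq> ideal.span (generators u)"
  unfolding I_tilde_eq_span
proof (rule ideal.span_minimal[OF _ ideal.subspace_span], rule Un_least)
  show "minors3 (plane_matrix (\<lambda>i. camera (u $ i))) \<subseteq> ideal.span (generators u)"
  proof
    fix g assume "g \<in> minors3 (plane_matrix (\<lambda>i. camera (u $ i)))"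
    then obtain r :: "3 \<Rightarrow> 4" and c :: "3 \<Rightarrow> 'm" where g: "g = det3 (plane_row u (r 1)) (plane_row u (r 2)) (plane_row u (r 3)) (c 1) (c 2) (c 3)"
      unfolding minors3_def det_submatrix_eq_det3 by blast
    show "g \<in> ideal.span (generators u)"
    proof (rule vanishing_on_scaled_points[OF u])
      fix l assume "l \<in> scaled_points u"
      then obtain s A B B' C C' where l: "\<And>j. l $ j $ 1 = s j * A"
        "\<And>j. l $ j $ 2 = s j * (B + u $ j * B')" "\<And>j. l $ j $ 3 = s j * (C + u $ j * C')"
        by (rule scaled_points_affine) blast
      note row = eval_plane_row[of l s A B u B' C C', OF l]
      obtain D1 D1' D2 D2' D3 D3' where
        "(\<lambda>j. eval_lpoly (plane_row u (r 1) j) l) = (\<lambda>j. s j * (D1 + u $ j * D1'))"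
        "(\<lambda>j. eval_lpoly (plane_row u (r 2) j) l) = (\<lambda>j. s j * (D2 + u $ j * D2'))"
        "(\<lambda>j. eval_lpoly (plane_row u (r 3) j) l) = (\<lambda>j. s j * (D3 + u $ j * D3'))"
        using row[of "r 1"] row[of "r 2"] row[of "r 3"] by blast
      then show "eval_lpoly g l = 0"
        by (simp only: g eval_det3 det3_affine[where u = "\<lambda>j. u $ j"])
    qed
  qed
  show "(\<lambda>s. det (Phi u s)) ` quadruples \<subseteq> ideal.span (generators u)"
  proof
    fix g assume "g \<in> (\<lambda>s. det (Phi u s)) ` quadruples"
    then obtain i j k l where "g = det (Phi u (i, j, k, l))" by auto
    then show "g \<in> ideal.span (generators u)"
      using det_Phi[of u i j k l] ideal.span_base[OF generatorsI(5)[of u i j k l]]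
        ideal.span_neg[OF ideal.span_base[OF generatorsI(5)[of u i j k l]]]
      by auto
  qed
qed

text \<open>These two rules reduce an alternating family to increasing indices.\<close>

lemma symmetric3_if_sorted:
  fixes P :: "'m::linorder \<Rightarrow> 'm \<Rightarrow> 'm \<Rightarrow> bool"
  assumes swap: "\<And>i j k. P i j k \<Longrightarrow> P j i k" "\<And>i j k. P i j k \<Longrightarrow> P i k j"
    and eq: "\<And>i k. P i i k" and sorted: "\<And>i j k. i < j \<Longrightarrow> j < k \<Longrightarrow> P i j k"
  shows "P i j k"
  using swap eq sorted by (metis linorder_neqE)

lemma symmetric4_if_sorted:
  fixes P :: "'m::linorder \<Rightarrow> 'm \<Rightarrow> 'm \<Rightarrow> 'm \<Rightarrow> bool"
  assumes swap: "\<And>i j k l. P i j k l \<Longrightarrow> P j i k l" "\<And>i j k l. P i j k l \<Longrightarrow> P i k j l"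
      "\<And>i j k l. P i j k l \<Longrightarrow> P i j l k"
    and eq: "\<And>i k l. P i i k l"
    and sorted: "\<And>i j k l. i < j \<Longrightarrow> j < k \<Longrightarrow> k < l \<Longrightarrow> P i j k l"
  shows "P i j k l"
proof -
  have "\<forall>l. P i j k l"
  proof (rule symmetric3_if_sorted[where P = "\<lambda>i j k. \<forall>l. P i j k l"])
    fix i j k :: 'm assume ijk: "i < j" "j < k"
    show "\<forall>l. P i j k l"
    proof
      fix l
      consider "l < i" | "l = i" | "i < l" "l < j" | "l = j" | "j < l" "l < k" | "l = k" | "k < l"
        by (metis linorder_neqE)
      then show "P i j k l"
      proof cases
        case 1 then show ?thesis using sorted[of l i j k] ijk swap by metis
      next
        case 2 then show ?thesis using eq[of i j k] swap by metis
      next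
        case 3 then show ?thesis using sorted[of i l j k] ijk swap by metis
      next
        case 4 then show ?thesis using eq[of j i k] swap by metis
      next
        case 5 then show ?thesis using sorted[of i j l k] ijk swap by metis
      next
        case 6 then show ?thesis using eq[of k i j] swap by metis
      next
        case 7 then show ?thesis using sorted[of i j k l] ijk by metis
      qed
    qed
  qed (use swap eq in blast)+
  then show ?thesis ..
qed

text \<open>In a numeral type \<open>n\<close> the index \<open>n = 0\<close> is the least one, so increasing choices list it first.\<close>

lemma order_3: "(3::3) < 1" "(1::3) < 2"
  by (simp_all add: less_bit1_def bit1.Rep_numeral bit1.Rep_1)

lemma order_4: "(4::4) < 1" "(1::4) < 2" "(2::4) < 3"
  by (simp_all add: less_bit0_def bit0.Rep_numeral bit0.Rep_1)

lemma strict_mono_3: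
  fixes f :: "3 \<Rightarrow> 'b::order"
  assumes "f 3 < f 1" "f 1 < f 2"
  shows "strict_mono f"
proof (rule strict_monoI)
  fix x y :: 3 assume "x < y"
  then show "f x < f y"
    using exhaust_3[of x] exhaust_3[of y] assms order_3 by (auto dest: less_trans less_asym)
qed

lemma det3_swap:
  fixes a b c :: "'m \<Rightarrow> 'a::comm_ring_1"
  shows "det3 a b c j i k = - det3 a b c i j k" "det3 a b c i k j = - det3 a b c i j k"
    "det3 a b c i i k = 0" "det3 a c b i j k = - det3 a b c i j k" "det3 b c a i j k = det3 a b c i j k"
    "det3 a b c j k i = det3 a b c i j k"
  by (simp_all add: det3_def algebra_simps)

lemma Q4_swap:
  fixes u y z :: "'m \<Rightarrow> 'a::comm_ring_1"
  shows "Q4 u y z j i k l = - Q4 u y z i j k l" "Q4 u y z i k j l = - Q4 u y z i j k l"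
    "Q4 u y z i j l k = - Q4 u y z i j k l" "Q4 u y z i i k l = 0"
  by (simp_all add: Q4_def algebra_simps)

lemma generators_subset_I_tilde:
  fixes u :: "complex ^ 'm::{finite,linorder}"
  shows "generators u \<subseteq> I_tilde u"
proof -
  let ?G = "minors3 (plane_matrix (\<lambda>i. camera (u $ i))) \<union> (\<lambda>s. det (Phi u s)) ` quadruples"
  have minor: "det3 (plane_row u r1) (plane_row u r2) (plane_row u r3) i j k \<in> ideal.span ?G"
    if r: "r3 < r1" "r1 < r2" for r1 r2 r3 i j k
  proof (rule symmetric3_if_sorted[where P = "\<lambda>i j k. det3 (plane_row u r1) (plane_row u r2) (plane_row u r3) i j k \<in> ideal.span ?G"], goal_cases)
    case (1 i j k)
    then show ?case by (subst det3_swap(1)) (rule ideal.span_neg)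
  next
    case (2 i j k)
    then show ?case by (subst det3_swap(2)) (rule ideal.span_neg)
  next
    case (3 i k)
    show ?case by (subst det3_swap(3)) (rule ideal.span_zero)
  next
    case (4 i j k)
    let ?r = "\<lambda>p :: 3. if p = 1 then r1 else if p = 2 then r2 else r3"
    let ?c = "\<lambda>p :: 3. if p = 1 then j else if p = 2 then k else i"
    have "strict_mono ?r" "strict_mono ?c" using r 4 by (auto intro!: strict_mono_3)
    then have "det ((\<chi> p q. plane_matrix (\<lambda>i. camera (u $ i)) $ ?r p $ ?c q) :: 'm lpoly ^ 3 ^ 3) \<in> ?G"
      unfolding minors3_def
      by (intro UnI1 CollectI exI[of _ ?r] exI[of _ ?c] conjI refl)
    then have "det3 (plane_row u r1) (plane_row u r2) (plane_row u r3) j k i \<in> ?G"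
      by (simp add: det_submatrix_eq_det3)
    then show ?case
      by (subst det3_swap(6)[symmetric]) (rule ideal.span_base)
  qed
  have row: "plane_row u 1 = Var 1" "plane_row u 2 = Var 2" "plane_row u 3 = Var 3"
    "plane_row u 4 = (\<lambda>j. Const (u $ j) * Var 1 j)"
    by (simp_all add: plane_row_def)
  show ?thesis
    unfolding I_tilde_eq_span
  proof
    fix g assume "g \<in> generators u"
    then show "g \<in> ideal.span ?G"
    proof (cases rule: generators_cases)
      case (1 i j k)
      have "det3 (plane_row u 1) (plane_row u 2) (plane_row u 4) i j k \<in> ideal.span ?G"
        by (intro minor order_4)
      from this[unfolded row] show ?thesis
        unfolding 1 by (subst det3_swap(4)) (rule ideal.span_neg)
    next
      case (2 i j k)
      have "det3 (plane_row u 1) (plane_row u 3) (plane_row u 4) i j k \<in> ideal.span ?G"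
        using order_4 by (intro minor) auto
      from this[unfolded row] show ?thesis
        unfolding 2 by (subst det3_swap(4)) (rule ideal.span_neg)
    next
      case (3 i j k)
      have "det3 (plane_row u 2) (plane_row u 3) (plane_row u 1) i j k \<in> ideal.span ?G"
        by (intro minor order_4)
      from this[unfolded row] show ?thesis
        unfolding 3 by (subst det3_swap(5)[symmetric])
    next
      case (4 i j k)
      have "det3 (plane_row u 2) (plane_row u 3) (plane_row u 4) i j k \<in> ideal.span ?G"
        using order_4 by (intro minor) auto
      from this[unfolded row] show ?thesis
        unfolding 4 by (subst det3_swap(5)[symmetric])
    next
      case (5 i j k l)
      let ?Q = "Q4 (\<lambda>j. Const (u $ j)) (Var 2) (Var 3)"
      have "?Q i j k l \<in> ideal.span ?G"
      proof (rule symmetric4_if_sorted[where P = "\<lambda>i j k l. ?Q i j k l \<in> ideal.span ?G"], goal_cases)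
        case (1 i j k l)
        then show ?case by (subst Q4_swap(1)) (rule ideal.span_neg)
      next
        case (2 i j k l)
        then show ?case by (subst Q4_swap(2)) (rule ideal.span_neg)
      next
        case (3 i j k l)
        then show ?case by (subst Q4_swap(3)) (rule ideal.span_neg)
      next
        case (4 i k l)
        show ?case by (subst Q4_swap(4)) (rule ideal.span_zero)
      next
        case (5 i j k l)
        then have "det (Phi u (i, j, k, l)) \<in> ideal.span ?G"
          by (intro ideal.span_base) (auto simp: quadruples_def)
        from this ideal.span_neg[OF this] show ?case
          using det_Phi[of u i j k l] by auto
      qed
      then show ?thesis unfolding 5 .
    qed
  qed
qed

theorem theorem6p4:
  fixes u :: "complex ^ 'm::{finite,linorder}"
  assumes "CARD('m) \<ge> 4"
    and "inj (\<lambda>i. center (camera (u $ i)))"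
  shows "I_tilde u = vanishing_ideal (line_multiview_variety (\<lambda>i. camera (u $ i)))"
proof -
  have u: "inj (\<lambda>j. u $ j)"
    using assms(2) by (auto simp: inj_def)
  have "ideal.span (generators u) \<subseteq> I_tilde u"
    using ideal.span_minimal[OF generators_subset_I_tilde] by (simp add: I_tilde_eq_span)
  then show ?thesis
    using I_tilde_subset[OF u] vanishing_ideal_line_multiview_variety[OF u] by blast
qed

end
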